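(* Let $\mathfrak g$ be a simple simply-laced Lie algebra of rank $r$ with Cartan matrix $C$, and let $k\ge1$. For all $\boldsymbol\ell=(\ell_\alpha)\in\mathbb Z_+^r$ and all $\mathbf n=(n_{\alpha,i})_{1\le\alpha\le r,\,1\le i\le k}$ with entries in $\mathbb Z_+$, $$M^{(k)}_{\boldsymbol\ell;\mathbf n}(q)=N^{(k)}_{\boldsymbol\ell;\mathbf n}(q).$$
   Context: $\mathbb Z_+=\{0,1,2,\dots\}$, $I_r=\{1,\dots,r\}$. For $a\in\mathbb Z_+$, $b\in\mathbb Z$, $\left[\begin{matrix}a+b\\ a\end{matrix}\right]_q$ is the coefficient of $x^a$ in $\prod_{i=0}^{b}(1-q^ix)^{-1}$ if $b\ge0$, and in $\prod_{i=0}^{-b-1}(1-q^{i+b+1}x)$ if $b<0$ (so it need not vanish for $b<0$). Let $A$ be the $k\times k$ matrix $A_{i,j}=\min(i,j)$. For $\mathbf m=(m_{\alpha,i})$, $\mathbf n=(n_{\alpha,i})$ ($\alpha\in I_r$, $1\le i\le k$) with entries in $\mathbb Z_+$ put $$\mathbf p=(p_{\alpha,i})=(I\otimes A)\mathbf n-(C\otimes A)\mathbf m,\qquad q_{\alpha,0}=\ell_\alpha-p_{\alpha,k},\qquad Q(\mathbf m,\mathbf n)=-\tfrac12\,\mathbf m\cdot\big(\mathbf p+(I\otimes A)\mathbf n\big).$$ The Laurent polynomials $M^{(k)}_{\boldsymbol\ell;\mathbf n}$, $N^{(k)}_{\boldsymbol\ell;\mathbf n}$ are defined by $$M^{(k)}_{\boldsymbol\ell;\mathbf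 n}(q^{-1})=\sum_{\substack{m_{\alpha,i}\in\mathbb Z_+\\ q_{\alpha,0}=0;\ p_{\alpha,i}\ge0}}q^{Q(\mathbf m,\mathbf n)}\prod_{\alpha=1}^r\prod_{i=1}^k\left[\begin{matrix}m_{\alpha,i}+p_{\alpha,i}\\ m_{\alpha,i}\end{matrix}\right]_q,$$ $$N^{(k)}_{\boldsymbol\ell;\mathbf n}(q^{-1})=\sum_{\substack{m_{\alpha,i}\in\mathbb Z_+\\ q_{\alpha,0}=0}}q^{Q(\mathbf m,\mathbf n)}\prod_{\alpha=1}^r\prod_{i=1}^k\left[\begin{matrix}m_{\alpha,i}+p_{\alpha,i}\\ m_{\alpha,i}\end{matrix}\right]_q,$$ where the conditions are imposed for all $\alpha\in I_r$ and $1\le i\le k$.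
   Formalization: For b<0 the q-binomial is taken from the product over 0≤i≤-b-2 rather than up to -b-1; with the upper limit -b-1 the identity fails (sl_2, k=2, ℓ=0, n=(0,1): M=0 but N≠0). *)

theory Defs
  imports
    Complex_Main
    "HOL-Library.Poly_Mapping"
    "HOL-Computational_Algebra.Formal_Power_Series"
begin

subsection \<open>Cartan matrices\<close>

text \<open>
  An integer matrix with rows and columns indexed by \<open>{1..r}\<close> is a function
  \<open>C :: nat \<Rightarrow> nat \<Rightarrow> int\<close> whose values outside \<open>{1..r}\<close> are irrelevant.

  The Cartan matrices of semisimple complex Lie algebras of rank \<open>r\<close> are the generalized Cartan
  matrices of finite type, that is, those of the form \<open>D S\<close> with \<open>D\<close> diagonal with positive entries
  and \<open>S\<close> symmetric positive definite. The algebra is simple iff the matrix is indecomposable, and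
  simply laced iff any two distinct nodes of the Dynkin diagram are joined by at most a simple edge.
\<close>

definition cartan_matrix :: "nat \<Rightarrow> (nat \<Rightarrow> nat \<Rightarrow> int) \<Rightarrow> bool" where
  "cartan_matrix r C \<longleftrightarrow>
     (\<forall>\<alpha>\<in>{1..r}. C \<alpha> \<alpha> = 2) \<and>
     (\<forall>\<alpha>\<in>{1..r}. \<forall>\<beta>\<in>{1..r}. \<alpha> \<noteq> \<beta> \<longrightarrow> C \<alpha> \<beta> \<le> 0) \<and>
     (\<forall>\<alpha>\<in>{1..r}. \<forall>\<beta>\<in>{1..r}. C \<alpha> \<beta> = 0 \<longleftrightarrow> C \<beta> \<alpha> = 0) \<and>
     (\<exists>(d :: nat \<Rightarrow> real) (S :: nat \<Rightarrow> nat \<Rightarrow> real).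
        (\<forall>\<alpha>\<in>{1..r}. d \<alpha> > 0) \<and>
        (\<forall>\<alpha>\<in>{1..r}. \<forall>\<beta>\<in>{1..r}. S \<alpha> \<beta> = S \<beta> \<alpha> \<and> of_int (C \<alpha> \<beta>) = d \<alpha> * S \<alpha> \<beta>) \<and>
        (\<forall>x :: nat \<Rightarrow> real. (\<exists>\<alpha>\<in>{1..r}. x \<alpha> \<noteq> 0) \<longrightarrow>
           (\<Sum>\<alpha>=1..r. \<Sum>\<beta>=1..r. x \<alpha> * S \<alpha> \<beta> * x \<beta>) > 0))"

definition indecomposable :: "nat \<Rightarrow> (nat \<Rightarrow> nat \<Rightarrow> int) \<Rightarrow> bool" where
  "indecomposable r C \<longleftrightarrow> r \<ge> 1 \<and>
     (\<forall>J. J \<subseteq> {1..r} \<and> J \<noteq> {} \<and> J \<noteq> {1..r} \<longrightarrow> (\<exists>\<alpha>\<in>J. \<exists>\<beta>\<in>{1..r} - J. C \<alpha> \<beta> \<noteq> 0))"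

definition simply_laced :: "nat \<Rightarrow> (nat \<Rightarrow> nat \<Rightarrow> int) \<Rightarrow> bool" where
  "simply_laced r C \<longleftrightarrow>
     (\<forall>\<alpha>\<in>{1..r}. \<forall>\<beta>\<in>{1..r}. \<alpha> \<noteq> \<beta> \<longrightarrow> C \<alpha> \<beta> = 0 \<or> C \<alpha> \<beta> = -1)"


subsection \<open>Laurent polynomials and quantum binomial coefficients\<close>

text \<open>
  The Laurent polynomial ring in \<open>q\<close> over the integers is the monoid algebra of \<open>(int, +)\<close>:
  finitely supported functions from exponents to coefficients, with convolution as product.
\<close>

type_synonym laurent_poly = "int \<Rightarrow>\<^sub>0 int"

definition qpow :: "int \<Rightarrow> laurent_poly" where
  "qpow j = Poly_Mapping.single j 1"

text \<open>The substitution of the inverse of \<open>q\<close> for \<open>q\<close>.\<close>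

definition q_inverse :: "laurent_poly \<Rightarrow> laurent_poly" where
  "q_inverse P = Poly_Mapping.map_key uminus P"

text \<open>
  \<open>qbinom a b\<close> is the \<open>q\<close>-binomial coefficient "\<open>a + b\<close> over \<open>a\<close>" for an arbitrary integer \<open>b\<close>, i.e.
  the product of \<open>(1 - q^(b + j)) / (1 - q^j)\<close> over \<open>1 \<le> j \<le> a\<close>. The second argument \<open>1\<close> of
  \<open>fps_left_inverse\<close> is the inverse of the constant term. For \<open>b < 0\<close> the last index of the product
  has to be \<open>-b - 2\<close>, the factors being those with exponents \<open>b + 1, \<dots>, -1\<close>; in particular the
  product is empty for \<open>b = -1\<close>.
\<close>

definition qbinom :: "nat \<Rightarrow> int \<Rightarrow> laurent_poly" where
  "qbinom a b =
     (if b \<ge> 0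
      then fps_nth (\<Prod>i=0..b. fps_left_inverse (1 - fps_const (qpow i) * fps_X) 1) a
      else fps_nth (\<Prod>i=0..-b-2. 1 - fps_const (qpow (i + b + 1)) * fps_X) a)"


subsection \<open>The sums\<close>

definition pvec ::
  "nat \<Rightarrow> nat \<Rightarrow> (nat \<Rightarrow> nat \<Rightarrow> int) \<Rightarrow> (nat \<Rightarrow> nat \<Rightarrow> nat) \<Rightarrow> (nat \<Rightarrow> nat \<Rightarrow> nat) \<Rightarrow> nat \<Rightarrow> nat \<Rightarrow> int"
where
  "pvec r k C m n \<alpha> i =
     (\<Sum>j=1..k. int (min i j) * int (n \<alpha> j))
     - (\<Sum>\<beta>=1..r. \<Sum>j=1..k. C \<alpha> \<beta> * int (min i j) * int (m \<beta> j))"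

definition q0 ::
  "nat \<Rightarrow> nat \<Rightarrow> (nat \<Rightarrow> nat \<Rightarrow> int) \<Rightarrow> (nat \<Rightarrow> nat) \<Rightarrow> (nat \<Rightarrow> nat \<Rightarrow> nat) \<Rightarrow> (nat \<Rightarrow> nat \<Rightarrow> nat) \<Rightarrow> nat \<Rightarrow> int"
where
  "q0 r k C l m n \<alpha> = int (l \<alpha>) - pvec r k C m n \<alpha> k"

text \<open>\<open>Qtwice\<close> is \<open>-2 Q\<close>; it is even for simply laced \<open>C\<close>, see \<open>even_Qtwice\<close>, so the division in \<open>Qexp\<close> is exact.\<close>

definition Qtwice ::
  "nat \<Rightarrow> nat \<Rightarrow> (nat \<Rightarrow> nat \<Rightarrow> int) \<Rightarrow> (nat \<Rightarrow> nat \<Rightarrow> nat) \<Rightarrow> (nat \<Rightarrow> nat \<Rightarrow> nat) \<Rightarrow> int"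
where
  "Qtwice r k C m n =
     (\<Sum>\<alpha>=1..r. \<Sum>i=1..k. int (m \<alpha> i) *
        (pvec r k C m n \<alpha> i + (\<Sum>j=1..k. int (min i j) * int (n \<alpha> j))))"

definition Qexp ::
  "nat \<Rightarrow> nat \<Rightarrow> (nat \<Rightarrow> nat \<Rightarrow> int) \<Rightarrow> (nat \<Rightarrow> nat \<Rightarrow> nat) \<Rightarrow> (nat \<Rightarrow> nat \<Rightarrow> nat) \<Rightarrow> int"
where
  "Qexp r k C m n = - (Qtwice r k C m n div 2)"

text \<open>
  Summation vectors \<open>m\<close> are represented by functions vanishing outside the index range. The set of
  admissible \<open>m\<close> is finite for a Cartan matrix, see \<open>finite_admissible\<close>.
\<close>

definition admissible ::
  "nat \<Rightarrow> nat \<Rightarrow> (nat \<Rightarrow> nat \<Rightarrow> int) \<Rightarrow> (nat \<Rightarrow> nat) \<Rightarrow> (nat \<Rightarrow> nat \<Rightarrow> nat) \<Rightarrow> (nat \<Rightarrow> nat \<Rightarrow> nat) set"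
where
  "admissible r k C l n =
     {m. (\<forall>\<alpha> i. \<alpha> \<notin> {1..r} \<or> i \<notin> {1..k} \<longrightarrow> m \<alpha> i = 0) \<and>
         (\<forall>\<alpha>\<in>{1..r}. q0 r k C l m n \<alpha> = 0)}"

definition summand ::
  "nat \<Rightarrow> nat \<Rightarrow> (nat \<Rightarrow> nat \<Rightarrow> int) \<Rightarrow> (nat \<Rightarrow> nat \<Rightarrow> nat) \<Rightarrow> (nat \<Rightarrow> nat \<Rightarrow> nat) \<Rightarrow> laurent_poly"
where
  "summand r k C m n =
     qpow (Qexp r k C m n) * (\<Prod>\<alpha>=1..r. \<Prod>i=1..k. qbinom (m \<alpha> i) (pvec r k C m n \<alpha> i))"

text \<open>The sums are the values of \<open>M\<close> and \<open>N\<close> at the inverse of \<open>q\<close>.\<close>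

definition M_poly ::
  "nat \<Rightarrow> nat \<Rightarrow> (nat \<Rightarrow> nat \<Rightarrow> int) \<Rightarrow> (nat \<Rightarrow> nat) \<Rightarrow> (nat \<Rightarrow> nat \<Rightarrow> nat) \<Rightarrow> laurent_poly"
where
  "M_poly r k C l n = q_inverse
     (\<Sum>m \<in> {m \<in> admissible r k C l n. \<forall>\<alpha>\<in>{1..r}. \<forall>i\<in>{1..k}. pvec r k C m n \<alpha> i \<ge> 0}.
        summand r k C m n)"

definition N_poly ::
  "nat \<Rightarrow> nat \<Rightarrow> (nat \<Rightarrow> nat \<Rightarrow> int) \<Rightarrow> (nat \<Rightarrow> nat) \<Rightarrow> (nat \<Rightarrow> nat \<Rightarrow> nat) \<Rightarrow> laurent_poly"
where
  "N_poly r k C l n = q_inverse (\<Sum>m \<in> admissible r k C l n. summand r k C m n)"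


subsection \<open>Well-definedness\<close>

lemma even_symmetric_form:
  fixes B :: "'a \<Rightarrow> 'a \<Rightarrow> int"
  assumes "finite J" "\<And>x. x \<in> J \<Longrightarrow> even (B x x)"
    and "\<And>x y. x \<in> J \<Longrightarrow> y \<in> J \<Longrightarrow> B x y = B y x"
  shows "even (\<Sum>x\<in>J. \<Sum>y\<in>J. B x y)"
  using assms
proof (induction J rule: finite_induct)
  case empty
  then show ?case by simp
next
  case (insert z J)
  have "(\<Sum>x\<in>J. B x z) = (\<Sum>x\<in>J. B z x)"
    by (rule sum.cong) (auto intro: insert.prems)
  then have "(\<Sum>x\<in>insert z J. \<Sum>y\<in>insert z J. B x y)
      = B z z + 2 * (\<Sum>x\<in>J. B z x) + (\<Sum>x\<in>J. \<Sum>y\<in>J. B x y)"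
    using insert.hyps by (simp add: sum.distrib)
  moreover have "even (\<Sum>x\<in>J. \<Sum>y\<in>J. B x y)"
    by (rule insert.IH) (auto intro: insert.prems)
  moreover have "even (B z z)" by (rule insert.prems) simp
  ultimately show ?case by simp
qed

lemma cartan_symmetric:
  assumes "cartan_matrix r C" "simply_laced r C" "\<alpha> \<in> {1..r}" "\<beta> \<in> {1..r}"
  shows "C \<alpha> \<beta> = C \<beta> \<alpha>"
  using assms unfolding cartan_matrix_def simply_laced_def by metis

lemma even_Qtwice:
  assumes "cartan_matrix r C" "simply_laced r C"
  shows "even (Qtwice r k C m n)"
proof -
  define J where "J = {1..r} \<times> {1..k}"
  define B where "B = (\<lambda>(\<alpha>, i) (\<beta>, j).
    int (m \<alpha> i) * (C \<alpha> \<beta> * int (min i j) * int (m \<beta> j)))"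
  have "even (\<Sum>x\<in>J. \<Sum>y\<in>J. B x y)"
  proof (rule even_symmetric_form)
    fix x assume "x \<in> J"
    then show "even (B x x)"
      using assms(1) by (auto simp: J_def B_def cartan_matrix_def)
  next
    fix x y assume "x \<in> J" "y \<in> J"
    then show "B x y = B y x"
      using cartan_symmetric[OF assms]
      by (auto simp: J_def B_def min.commute mult.commute mult.left_commute)
  qed (simp add: J_def)
  moreover have "(\<Sum>x\<in>J. \<Sum>y\<in>J. B x y) = (\<Sum>\<alpha>=1..r. \<Sum>i=1..k. int (m \<alpha> i) *
      (\<Sum>\<beta>=1..r. \<Sum>j=1..k. C \<alpha> \<beta> * int (min i j) * int (m \<beta> j)))"
    unfolding J_def by (simp add: B_def sum.cartesian_product' sum_distrib_left)
  moreover have "Qtwice r k C m n =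
      2 * (\<Sum>\<alpha>=1..r. \<Sum>i=1..k. int (m \<alpha> i) * (\<Sum>j=1..k. int (min i j) * int (n \<alpha> j)))
      - (\<Sum>\<alpha>=1..r. \<Sum>i=1..k. int (m \<alpha> i) *
          (\<Sum>\<beta>=1..r. \<Sum>j=1..k. C \<alpha> \<beta> * int (min i j) * int (m \<beta> j)))"
    unfolding Qtwice_def pvec_def
    by (simp add: distrib_left right_diff_distrib sum.distrib sum_subtractf)
      (simp add: sum_distrib_left mult_ac)
  ultimately show ?thesis by simp
qed

lemma cartan_injective:
  fixes x :: "nat \<Rightarrow> real"
  assumes "cartan_matrix r C"
    and ker: "\<And>\<alpha>. \<alpha> \<in> {1..r} \<Longrightarrow> (\<Sum>\<beta>=1..r. of_int (C \<alpha> \<beta>) * x \<beta>) = 0"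
    and "\<alpha> \<in> {1..r}"
  shows "x \<alpha> = 0"
proof (rule ccontr)
  assume "x \<alpha> \<noteq> 0"
  from assms(1) obtain d S where d: "\<And>\<alpha>. \<alpha> \<in> {1..r} \<Longrightarrow> d \<alpha> > (0 :: real)"
    and S: "\<And>\<alpha> \<beta>. \<alpha> \<in> {1..r} \<Longrightarrow> \<beta> \<in> {1..r} \<Longrightarrow> of_int (C \<alpha> \<beta>) = d \<alpha> * S \<alpha> \<beta>"
    and pos: "\<And>x. \<exists>\<alpha>\<in>{1..r}. x \<alpha> \<noteq> 0 \<Longrightarrow>
      (\<Sum>\<alpha>=1..r. \<Sum>\<beta>=1..r. x \<alpha> * S \<alpha> \<beta> * x \<beta>) > (0 :: real)"
    unfolding cartan_matrix_def by blast
  have "(\<Sum>\<beta>=1..r. S \<alpha> \<beta> * x \<beta>) = 0" if "\<alpha> \<in> {1..r}" for \<alpha>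
  proof -
    have "d \<alpha> * (\<Sum>\<beta>=1..r. S \<alpha> \<beta> * x \<beta>) = (\<Sum>\<beta>=1..r. of_int (C \<alpha> \<beta>) * x \<beta>)"
      unfolding sum_distrib_left by (rule sum.cong) (use S that in auto)
    with ker[OF that] d[OF that] show ?thesis by simp
  qed
  then have "(\<Sum>\<alpha>=1..r. x \<alpha> * (\<Sum>\<beta>=1..r. S \<alpha> \<beta> * x \<beta>)) = 0" by simp
  then have "(\<Sum>\<alpha>=1..r. \<Sum>\<beta>=1..r. x \<alpha> * S \<alpha> \<beta> * x \<beta>) = 0"
    by (simp add: sum_distrib_left mult.assoc)
  with pos[of x] \<open>x \<alpha> \<noteq> 0\<close> assms(3) show False by fastforce
qed

lemma finite_admissible:
  assumes "cartan_matrix r C"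
  shows "finite (admissible r k C l n)"
proof (cases "admissible r k C l n = {}")
  case False
  then obtain m0 where m0: "m0 \<in> admissible r k C l n" by blast
  define t :: "(nat \<Rightarrow> nat \<Rightarrow> nat) \<Rightarrow> nat \<Rightarrow> nat"
    where "t = (\<lambda>m \<alpha>. \<Sum>j=1..k. j * m \<alpha> j)"
  have charge: "(\<Sum>\<beta>=1..r. C \<alpha> \<beta> * int (t m \<beta>)) = (\<Sum>j=1..k. int j * int (n \<alpha> j)) - int (l \<alpha>)"
    if "m \<in> admissible r k C l n" "\<alpha> \<in> {1..r}" for m \<alpha>
  proof -
    have "(\<Sum>\<beta>=1..r. \<Sum>j=1..k. C \<alpha> \<beta> * int (min k j) * int (m \<beta> j))
        = (\<Sum>\<beta>=1..r. C \<alpha> \<beta> * int (t m \<beta>))"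
      unfolding t_def of_nat_sum sum_distrib_left
      by (intro sum.cong refl) (auto simp: min_def)
    moreover have "(\<Sum>j=1..k. int (min k j) * int (n \<alpha> j)) = (\<Sum>j=1..k. int j * int (n \<alpha> j))"
      by (intro sum.cong refl) (auto simp: min_def)
    ultimately show ?thesis
      using that by (simp add: admissible_def q0_def pvec_def)
  qed
  have t: "t m \<alpha> = t m0 \<alpha>" if m: "m \<in> admissible r k C l n" and "\<alpha> \<in> {1..r}" for m \<alpha>
  proof -
    have "(\<Sum>\<beta>=1..r. of_int (C \<alpha> \<beta>) * (real (t m \<beta>) - real (t m0 \<beta>))) = 0"
      if "\<alpha> \<in> {1..r}" for \<alpha>
    proof -
      have "(\<Sum>\<beta>=1..r. of_int (C \<alpha> \<beta>) * (real (t m \<beta>) - real (t m0 \<beta>)))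
          = of_int ((\<Sum>\<beta>=1..r. C \<alpha> \<beta> * int (t m \<beta>)) - (\<Sum>\<beta>=1..r. C \<alpha> \<beta> * int (t m0 \<beta>)))"
        by (simp add: sum_subtractf algebra_simps)
      with charge[OF m that] charge[OF m0 that] show ?thesis by simp
    qed
    from cartan_injective[OF assms this \<open>\<alpha> \<in> {1..r}\<close>] show ?thesis by simp
  qed
  define b where "b = (\<Sum>\<alpha>=1..r. t m0 \<alpha>)"
  have le: "m \<alpha> i \<le> b" if m: "m \<in> admissible r k C l n" for m \<alpha> i
  proof (cases "\<alpha> \<in> {1..r} \<and> i \<in> {1..k}")
    case True
    have "m \<alpha> i \<le> i * m \<alpha> i" using True by simp
    also have "\<dots> \<le> t m \<alpha>"
      unfolding t_def by (rule member_le_sum[of i "{1..k}" "\<lambda>j. j * m \<alpha> j"]) (use True in auto)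
    also have "\<dots> = t m0 \<alpha>" using t m True by blast
    also have "\<dots> \<le> b"
      unfolding b_def by (rule member_le_sum[of \<alpha> "{1..r}" "t m0"]) (use True in auto)
    finally show ?thesis .
  qed (use m in \<open>auto simp: admissible_def\<close>)
  define F where "F = {f :: nat \<times> nat \<Rightarrow> nat.
    \<forall>x. (x \<in> {1..r} \<times> {1..k} \<longrightarrow> f x \<in> {..b}) \<and> (x \<notin> {1..r} \<times> {1..k} \<longrightarrow> f x = 0)}"
  have "finite F"
    unfolding F_def by (rule finite_set_of_finite_funs) auto
  moreover have "admissible r k C l n \<subseteq> curry ` F"
  proof
    fix m assume m: "m \<in> admissible r k C l n"
    then have "case_prod m \<in> F"
      using le[OF m] by (auto simp: F_def admissible_def)
    then show "m \<in> curry ` F" by (metis curry_case_prod image_eqI)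
  qed
  ultimately show ?thesis by (meson finite_imageI finite_subset)
qed simp

end

theory Submission
  imports Defs "HOL-Library.Function_Algebras"
begin

text \<open>
  Extend \<open>N\<close> to integer \<open>l\<close> and \<open>n\<close>. The quantum Pascal rule turns the quantum Q-system into a
  relation between the values of the extended sum at \<open>n + 2 e\<^sub>\<alpha>\<^sub>,\<^sub>i\<close>, \<open>n + e\<^sub>\<alpha>\<^sub>,\<^sub>i\<^sub>-\<^sub>1 + e\<^sub>\<alpha>\<^sub>,\<^sub>i\<^sub>+\<^sub>1\<close> and
  \<open>n + \<Sum>\<^sub>\<beta> e\<^sub>\<beta>\<^sub>,\<^sub>i\<close>, with \<open>\<beta>\<close> running over the neighbours of \<open>\<alpha>\<close>, valid for all integer \<open>n\<close>.

  Fix the \<open>m\<^sub>i\<close> with \<open>i > j\<close>, where \<open>j\<close> is the last index at which some \<open>p\<^sub>\<alpha>\<^sub>,\<^sub>j\<close> is negative. The sum over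
  the remaining \<open>m\<^sub>i\<close> is a monomial times the extended sum of level \<open>j + 1\<close> with all \<open>l = -1\<close>, at
  parameters that are nonnegative at the node \<open>\<alpha>\<close> and arbitrary integers at the other nodes.
  Such a sum vanishes. This expresses that the \<open>Q\<^sub>\<alpha>\<^sub>,\<^sub>i\<close> are polynomials in \<open>Q\<^sub>\<alpha>\<^sub>,\<^sub>1\<close> once the \<open>Q\<^sub>\<beta>\<^sub>,\<^sub>i\<close>
  at the other nodes are inverted: with \<open>x\<^sub>i = Q\<^sub>\<alpha>\<^sub>,\<^sub>i\<close> and \<open>c\<^sub>i\<close> the product of the neighbouring \<open>Q\<^sub>\<beta>\<^sub>,\<^sub>i\<close>,
  the relations give, for \<open>q = 1\<close>,
  \<open>c\<^sub>i\<^sub>-\<^sub>1 x\<^sub>i\<^sub>+\<^sub>2 = u - x\<^sub>i\<^sub>+\<^sub>1\<^sup>2 x\<^sub>i\<^sub>-\<^sub>2 - x\<^sub>i\<^sup>3 + 2 x\<^sub>i\<^sub>-\<^sub>1 x\<^sub>i x\<^sub>i\<^sub>+\<^sub>1\<close>, where \<open>c\<^sub>i\<^sub>-\<^sub>1 c\<^sub>i\<^sub>+\<^sub>1 = c\<^sub>i\<^sup>2 - x\<^sub>i u\<close>; the factor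
  \<open>x\<^sub>i\<close> of \<open>x\<^sub>i x\<^sub>i\<^sub>+\<^sub>2 = x\<^sub>i\<^sub>+\<^sub>1\<^sup>2 - c\<^sub>i\<^sub>+\<^sub>1\<close> has cancelled. Hence the top exponent at \<open>\<alpha>\<close> can be lowered to \<open>0\<close>,
  where expanding only the neighbours decreases the level.
\<close>

subsection \<open>Quantum binomial coefficients\<close>

lemma qpow_0: "qpow 0 = 1"
  by (simp add: qpow_def)

lemma qpow_add: "qpow (i + j) = qpow i * qpow j"
  by (simp add: qpow_def mult_single)

definition qbinom_series :: "int \<Rightarrow> laurent_poly fps" where
  "qbinom_series b =
     (if b \<ge> 0
      then \<Prod>i=0..b. fps_left_inverse (1 - fps_const (qpow i) * fps_X) 1
      else \<Prod>i=0..-b-2. 1 - fps_const (qpow (i + b + 1)) * fps_X)"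

lemma qbinom_eq_nth: "qbinom a b = fps_nth (qbinom_series b) a"
  by (simp add: qbinom_def qbinom_series_def)

text \<open>Both branches of the definition obey one functional equation, and at b = 0 it joins
  them. Later facts about \<open>qbinom\<close> use only this and the empty product at b =
  -1.\<close>

lemma qbinom_series_step:
  "qbinom_series b * (1 - fps_const (qpow b) * fps_X) = qbinom_series (b - 1)"
proof -
  let ?f = "\<lambda>i. 1 - fps_const (qpow i) * fps_X :: laurent_poly fps"
  consider "b > 0" | "b = 0" | "b < 0" by linarith
  then show ?thesis
  proof cases
    case 1
    have "fps_left_inverse (?f b) 1 * ?f b = 1"
      by (rule fps_left_inverse) simp
    moreover have "{0..b} = insert b {0..b-1}" using 1 by auto
    ultimately show ?thesis
      using 1 by (simp add: qbinom_series_def mult_ac)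
  next
    case 2
    have "fps_left_inverse (?f 0) 1 * ?f 0 = 1"
      by (rule fps_left_inverse) simp
    then show ?thesis using 2 by (simp add: qbinom_series_def)
  next
    case 3
    have "(\<Prod>i=0..-1-b. ?f (i + b)) = ?f b * (\<Prod>i=1..-1-b. ?f (i + b))"
    proof -
      have "{0..-1-b} = insert 0 {1..-1-b}" using 3 by auto
      then show ?thesis by simp
    qed
    also have "(\<Prod>i=1..-1-b. ?f (i + b)) = (\<Prod>i=0..-b-2. ?f (i + b + 1))"
      by (rule prod.reindex_bij_witness[of _ "\<lambda>i. i + 1" "\<lambda>i. i - 1"]) auto
    finally have "(\<Prod>i=0..-1-b. ?f (i + b)) = ?f b * (\<Prod>i=0..-b-2. ?f (i + b + 1))" .
    then show ?thesis
      using 3 by (simp add: qbinom_series_def mult.commute)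
  qed
qed

lemma qbinom_0: "qbinom 0 b = 1"
proof (induction b rule: int_induct[where k = "-1"])
  case base
  show ?case by (simp add: qbinom_eq_nth qbinom_series_def)
next
  case (step1 i)
  then show ?case
    using arg_cong[OF qbinom_series_step[of "i + 1"], of "\<lambda>f. fps_nth f 0"]
    by (simp add: qbinom_eq_nth)
next
  case (step2 i)
  then show ?case
    using arg_cong[OF qbinom_series_step[of i], of "\<lambda>f. fps_nth f 0"] by (simp add: qbinom_eq_nth)
qed

lemma qbinom_minus_one: "qbinom a (-1) = (if a = 0 then 1 else 0)"
  by (simp add: qbinom_eq_nth qbinom_series_def)

lemma qbinom_pascal: "qbinom (Suc a) b = qbinom (Suc a) (b - 1) + qpow b * qbinom a b"
proof -
  let ?F = "qbinom_series b"
  have "?F - fps_const (qpow b) * (?F * fps_X) = qbinom_series (b - 1)"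
    using qbinom_series_step[of b] by (simp add: right_diff_distrib mult.left_commute)
  then have "fps_nth (?F - fps_const (qpow b) * (?F * fps_X)) (Suc a) = qbinom (Suc a) (b - 1)"
    by (simp add: qbinom_eq_nth)
  then show ?thesis by (simp add: qbinom_eq_nth diff_eq_eq)
qed

lemma qbinom_zero: "qbinom a 0 = 1"
proof (induction a)
  case (Suc a)
  then show ?case
    using qbinom_pascal[of a 0] by (simp add: qbinom_minus_one qpow_0)
qed (rule qbinom_0)

text \<open>By the first Pascal rule the defect satisfies
  \<open>E (Suc a) b - E (Suc a) (b - 1) = qpow b * E a b\<close>, and \<open>E a 0 = 0\<close>. So
  it vanishes by induction on a and, from b = 0, on b in both directions.\<close>

lemma qbinom_pascal':
  "qbinom (Suc a) b = qpow (int (Suc a)) * qbinom (Suc a) (b - 1) + qbinom a b"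
proof -
  define E where "E a b = qbinom (Suc a) b - qpow (int (Suc a)) * qbinom (Suc a) (b - 1) - qbinom a b"
    for a b
  have E0: "E a 0 = 0" for a
    by (simp add: E_def qbinom_zero qbinom_minus_one)
  have "E a b = 0" for a b
  proof (induction a arbitrary: b)
    case 0
    have step: "E 0 b = E 0 (b - 1)" for b
      using qbinom_pascal[of 0 b] qbinom_pascal[of 0 "b - 1"] qpow_add[of 1 "b - 1"]
      by (simp add: E_def qbinom_0 algebra_simps)
    show ?case
      by (induction b rule: int_induct[where k = 0]) (use E0 step in \<open>auto, metis add_diff_cancel_right'\<close>)
  next
    case (Suc a)
    have step: "E (Suc a) b = E (Suc a) (b - 1)" for b
    proof -
      define A B where "A = qpow (int (Suc a))" and "B = qpow b"
      have AB: "qpow (int (Suc (Suc a))) * qpow (b - 1) = B * A"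
        by (simp add: A_def B_def algebra_simps flip: qpow_add)
      have "E (Suc a) b - E (Suc a) (b - 1) = B * qbinom (Suc a) b
          - (qpow (int (Suc (Suc a))) * qpow (b - 1)) * qbinom (Suc a) (b - 1) - B * qbinom a b"
        unfolding E_def qbinom_pascal[of "Suc a" b] qbinom_pascal[of "Suc a" "b - 1"]
          qbinom_pascal[of a b] B_def
        by (simp only: diff_diff_eq2 right_diff_distrib distrib_left distrib_right left_diff_distrib mult.assoc)
          (simp del: of_nat_Suc)
      also have "\<dots> = B * E a b"
        unfolding AB E_def A_def by (simp only: right_diff_distrib mult.assoc)
      finally have "E (Suc a) b - E (Suc a) (b - 1) = qpow b * E a b"
        unfolding B_def .
      with Suc show ?thesis by simp
    qed
    show ?case
      by (induction b rule: int_induct[where k = 0]) (use E0 step in \<open>auto, metis add_diff_cancel_right'\<close>)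
  qed
  then have "E a b = 0" .
  then show ?thesis by (simp add: E_def algebra_simps)
qed

subsection \<open>Fermionic sums with integer parameters\<close>

definition minsum :: "nat \<Rightarrow> (nat \<Rightarrow> int) \<Rightarrow> nat \<Rightarrow> int" where
  "minsum k f i = (\<Sum>j=1..k. int (min i j) * f j)"

lemma minsum_add: "minsum k (f + g) i = minsum k f i + minsum k g i"
  by (simp add: minsum_def distrib_left sum.distrib)

lemma minsum_0 [simp]: "minsum k f 0 = 0"
  by (simp add: minsum_def)

lemma minsum_cong:
  assumes "\<And>j. j \<in> {1..k} \<Longrightarrow> f j = g j"
  shows "minsum k f i = minsum k g i"
  unfolding minsum_def by (rule sum.cong) (use assms in auto)

lemma minsum_split:
  assumes "j \<le> k" "i \<le> j"
  shows "minsum k f i = minsum j f i + int i * (\<Sum>j'\<in>{j<..k}. f j')"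
proof -
  have "{1..k} = {1..j} \<union> {j<..k}" "{1..j} \<inter> {j<..k} = {}" using assms by auto
  then have "minsum k f i = minsum j f i + (\<Sum>j'\<in>{j<..k}. int (min i j') * f j')"
    unfolding minsum_def by (simp only: sum.union_disjoint finite_atLeastAtMost finite_greaterThanAtMost)
  also have "(\<Sum>j'\<in>{j<..k}. int (min i j') * f j') = (\<Sum>j'\<in>{j<..k}. int i * f j')"
    by (rule sum.cong) (use assms in auto)
  finally show ?thesis by (simp add: sum_distrib_left)
qed

text \<open>The matrix min(i, j) is the Green function of the discrete Laplacian that is 0 at i = 0
  and constant from k on. Hence \<open>Suc (Suc i)\<close> may equal k + 1.\<close>

lemma minsum_second_difference:
  assumes "i < k"
  shows "minsum k f i + minsum k f (Suc (Suc i)) = 2 * minsum k f (Suc i) - f (Suc i)"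
proof -
  have "(\<Sum>j=1..k. int (min i j) * f j + int (min (Suc (Suc i)) j) * f j)
      = (\<Sum>j=1..k. 2 * (int (min (Suc i) j) * f j) - (if j = Suc i then f j else 0))"
    by (rule sum.cong) (auto simp: min_def algebra_simps)
  then show ?thesis
    using assms by (simp add: minsum_def sum.distrib sum_subtractf sum_distrib_left)
qed

lemma minsum_Suc_diff:
  assumes "j < k"
  shows "minsum k f (Suc j) = minsum k f j + (\<Sum>i\<in>{j<..k}. f i)"
proof -
  have "{i \<in> {1..k}. j < i} = {j<..k}" by auto
  moreover have "(\<Sum>i=1..k. int (min (Suc j) i) * f i)
      = (\<Sum>i=1..k. int (min j i) * f i + (if j < i then f i else 0))"
    by (rule sum.cong) (auto simp: min_def algebra_simps)
  ultimately show ?thesis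
    by (simp add: minsum_def sum.distrib flip: sum.inter_filter)
qed

lemma minsum_diff_cong:
  assumes "j \<le> i" "\<And>x. j < x \<Longrightarrow> f x = g x"
  shows "minsum k f i - minsum k f j = minsum k g i - minsum k g j"
proof -
  have "(\<Sum>x=1..k. int (min i x) * f x - int (min j x) * f x)
      = (\<Sum>x=1..k. int (min i x) * g x - int (min j x) * g x)"
  proof (rule sum.cong)
    fix x
    show "int (min i x) * f x - int (min j x) * f x = int (min i x) * g x - int (min j x) * g x"
      using assms by (cases "x \<le> j") auto
  qed simp
  then show ?thesis by (simp add: minsum_def sum_subtractf)
qed

text \<open>Position i = 0 is meaningful: \<open>minsum\<close> does not see it, which encodes the
  boundary value 1 of the Q-system at index 0.\<close>

definition unit_vec :: "nat \<Rightarrow> nat \<Rightarrow> nat \<Rightarrow> nat \<Rightarrow> int" where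
  "unit_vec \<alpha> i \<beta> j = (if \<beta> = \<alpha> \<and> j = i then 1 else 0)"

lemma minsum_unit_vec:
  assumes "i \<le> k"
  shows "minsum k (unit_vec \<alpha> i \<beta>) j = (if \<beta> = \<alpha> then int (min j i) else 0)"
proof -
  have "minsum k (unit_vec \<alpha> i \<beta>) j
      = (\<Sum>j'=1..k. if j' = i then (if \<beta> = \<alpha> then int (min j i) else 0) else 0)"
    unfolding minsum_def unit_vec_def by (rule sum.cong) auto
  then show ?thesis using assms by auto
qed

section \<open>Cartan data and the extended sums\<close>

locale simply_laced_cartan =
  fixes r :: nat and C :: "nat \<Rightarrow> nat \<Rightarrow> int"
  assumes cartan: "cartan_matrix r C" and laced: "simply_laced r C"
begin

lemma C_sym: "\<alpha> \<in> {1..r} \<Longrightarrow> \<beta> \<in> {1..r} \<Longrightarrow> C \<alpha> \<beta> = C \<beta> \<alpha>"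
  by (rule cartan_symmetric[OF cartan laced])

lemma C_diag: "\<alpha> \<in> {1..r} \<Longrightarrow> C \<alpha> \<alpha> = 2"
  using cartan by (auto simp: cartan_matrix_def)

definition neighbours :: "nat \<Rightarrow> nat set" where
  "neighbours \<alpha> = {\<beta> \<in> {1..r}. C \<alpha> \<beta> = -1}"

lemma finite_neighbours [simp]: "finite (neighbours \<alpha>)"
  by (simp add: neighbours_def)

lemma neighbours_irrefl: "\<alpha> \<in> {1..r} \<Longrightarrow> \<alpha> \<notin> neighbours \<alpha>"
  by (simp add: neighbours_def C_diag)

lemma neighbours_sym: "\<alpha> \<in> {1..r} \<Longrightarrow> \<beta> \<in> neighbours \<alpha> \<Longrightarrow> \<alpha> \<in> neighbours \<beta>"
  using C_sym[of \<alpha> \<beta>] by (simp add: neighbours_def)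

lemma C_eq:
  assumes "\<alpha> \<in> {1..r}" "\<beta> \<in> {1..r}"
  shows "C \<alpha> \<beta> = (if \<alpha> = \<beta> then 2 else if \<beta> \<in> neighbours \<alpha> then -1 else 0)"
proof -
  have "C \<alpha> \<beta> = 0 \<or> C \<alpha> \<beta> = -1" if "\<alpha> \<noteq> \<beta>"
    using laced assms that by (simp add: simply_laced_def)
  then show ?thesis using assms C_diag[of \<alpha>] by (auto simp: neighbours_def)
qed

definition neighbour_vec :: "nat \<Rightarrow> nat \<Rightarrow> nat \<Rightarrow> nat \<Rightarrow> int" where
  "neighbour_vec \<alpha> i = (\<Sum>\<beta>\<in>neighbours \<alpha>. unit_vec \<beta> i)"

lemma neighbour_vec_apply:
  "neighbour_vec \<alpha> i \<beta> j = (if \<beta> \<in> neighbours \<alpha> \<and> j = i then 1 else 0)"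
proof -
  have "(\<Sum>\<beta>\<in>B. unit_vec \<beta> i) \<beta> j = (if \<beta> \<in> B \<and> j = i then 1 else 0)" if "finite B" for B
    using that by (induction B) (auto simp: unit_vec_def)
  then show ?thesis by (simp add: neighbour_vec_def)
qed

text \<open>Minus the second difference of \<open>vacancy\<close> in its last index, hence local in
  j.\<close>

definition gap :: "(nat \<Rightarrow> nat \<Rightarrow> nat) \<Rightarrow> (nat \<Rightarrow> nat \<Rightarrow> int) \<Rightarrow> nat \<Rightarrow> nat \<Rightarrow> int" where
  "gap m n \<alpha> j = n \<alpha> j - (\<Sum>\<beta>=1..r. C \<alpha> \<beta> * int (m \<beta> j))"

text \<open>\<open>vacancy\<close> is \<open>p\<close>, \<open>energy\<close> is \<open>-2 Q\<close>, and \<open>configs\<close> is cut out by \<open>p\<^sub>\<alpha>\<^sub>,\<^sub>k = l\<^sub>\<alpha>\<close>.\<close>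

definition vacancy :: "nat \<Rightarrow> (nat \<Rightarrow> nat \<Rightarrow> nat) \<Rightarrow> (nat \<Rightarrow> nat \<Rightarrow> int) \<Rightarrow> nat \<Rightarrow> nat \<Rightarrow> int" where
  "vacancy k m n \<alpha> = minsum k (gap m n \<alpha>)"

definition energy :: "nat \<Rightarrow> (nat \<Rightarrow> nat \<Rightarrow> nat) \<Rightarrow> (nat \<Rightarrow> nat \<Rightarrow> int) \<Rightarrow> int" where
  "energy k m n =
     (\<Sum>\<alpha>=1..r. \<Sum>i=1..k. int (m \<alpha> i) * (vacancy k m n \<alpha> i + minsum k (n \<alpha>) i))"

definition configs :: "nat \<Rightarrow> (nat \<Rightarrow> int) \<Rightarrow> (nat \<Rightarrow> nat \<Rightarrow> int) \<Rightarrow> (nat \<Rightarrow> nat \<Rightarrow> nat) set" where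
  "configs k l n =
     {m. (\<forall>\<alpha> i. \<alpha> \<notin> {1..r} \<or> i \<notin> {1..k} \<longrightarrow> m \<alpha> i = 0) \<and>
         (\<forall>\<alpha>\<in>{1..r}. vacancy k m n \<alpha> k = l \<alpha>)}"

definition weight :: "nat \<Rightarrow> (nat \<Rightarrow> nat \<Rightarrow> nat) \<Rightarrow> (nat \<Rightarrow> nat \<Rightarrow> int) \<Rightarrow> laurent_poly" where
  "weight k m n = qpow (- (energy k m n div 2)) *
     (\<Prod>x\<in>{1..r} \<times> {1..k}. qbinom (m (fst x) (snd x)) (vacancy k m n (fst x) (snd x)))"

definition fsum :: "nat \<Rightarrow> (nat \<Rightarrow> int) \<Rightarrow> (nat \<Rightarrow> nat \<Rightarrow> int) \<Rightarrow> laurent_poly" where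
  "fsum k l n = (\<Sum>m\<in>configs k l n. weight k m n)"

section \<open>Comparison with the original sums\<close>

lemma pvec_eq_vacancy: "pvec r k C m n \<alpha> i = vacancy k m (\<lambda>\<alpha> i. int (n \<alpha> i)) \<alpha> i"
proof -
  have "(\<Sum>\<beta>=1..r. \<Sum>j=1..k. C \<alpha> \<beta> * int (min i j) * int (m \<beta> j))
      = (\<Sum>j=1..k. int (min i j) * (\<Sum>\<beta>=1..r. C \<alpha> \<beta> * int (m \<beta> j)))"
    by (subst sum.swap) (simp add: sum_distrib_left mult_ac)
  then show ?thesis
    by (simp add: pvec_def vacancy_def minsum_def gap_def right_diff_distrib sum_subtractf)
qed

lemma admissible_eq_configs:
  "admissible r k C l n = configs k (\<lambda>\<alpha>. int (l \<alpha>)) (\<lambda>\<alpha> i. int (n \<alpha> i))"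
  unfolding admissible_def configs_def q0_def pvec_eq_vacancy by fastforce

lemma summand_eq_weight: "summand r k C m n = weight k m (\<lambda>\<alpha> i. int (n \<alpha> i))"
  unfolding summand_def weight_def Qexp_def Qtwice_def pvec_eq_vacancy energy_def
  by (simp add: minsum_def prod.cartesian_product case_prod_beta)

text \<open>The part linear in n occurs twice; what remains is the Cartan form in m, which is
  \<open>Qtwice\<close> at n = 0.\<close>

lemma even_energy: "even (energy k m n)"
proof -
  have vac: "vacancy k m n \<alpha> i + minsum k (n \<alpha>) i
      = 2 * minsum k (n \<alpha>) i + pvec r k C m (\<lambda>_ _. 0) \<alpha> i" for \<alpha> i
    unfolding pvec_eq_vacancy
    by (simp add: vacancy_def minsum_def gap_def right_diff_distrib sum_subtractf sum_negf)
  then have "energy k m n = 2 * (\<Sum>\<alpha>=1..r. \<Sum>i=1..k. int (m \<alpha> i) * minsum k (n \<alpha>) i)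
      + Qtwice r k C m (\<lambda>_ _. 0)"
    unfolding energy_def Qtwice_def
    by (simp add: vac distrib_left sum.distrib mult.left_commute flip: sum_distrib_left)
  then show ?thesis using even_Qtwice[OF cartan laced] by simp
qed

text \<open>As \<open>min k j = j\<close>, the condition at k is a linear system for these charges
  with matrix C, which is injective. This yields finiteness and, in \<open>fsum_tail\<close>, a
  constant energy shift.\<close>

lemma charge_determined:
  assumes m: "m \<in> configs k l n" and m': "m' \<in> configs k l n" and "\<alpha> \<in> {1..r}"
  shows "(\<Sum>j=1..k. j * m \<alpha> j) = (\<Sum>j=1..k. j * m' \<alpha> j)"
proof -
  define t where "t m \<alpha> = (\<Sum>j=1..k. j * m \<alpha> j)" for m :: "nat \<Rightarrow> nat \<Rightarrow> nat" and \<alpha>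
  have charge: "(\<Sum>\<beta>=1..r. C \<alpha> \<beta> * int (t m \<beta>)) = minsum k (n \<alpha>) k - l \<alpha>"
    if m: "m \<in> configs k l n" and "\<alpha> \<in> {1..r}" for m \<alpha>
  proof -
    have "(\<Sum>\<beta>=1..r. C \<alpha> \<beta> * int (t m \<beta>))
        = (\<Sum>\<beta>=1..r. \<Sum>j=1..k. int (min k j) * (C \<alpha> \<beta> * int (m \<beta> j)))"
      unfolding t_def of_nat_sum sum_distrib_left
      by (intro sum.cong refl) (auto simp: min_def)
    also have "\<dots> = (\<Sum>j=1..k. int (min k j) * (\<Sum>\<beta>=1..r. C \<alpha> \<beta> * int (m \<beta> j)))"
      by (subst sum.swap) (simp add: sum_distrib_left)
    also have "\<dots> = minsum k (n \<alpha>) k - vacancy k m n \<alpha> k"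
      by (simp add: vacancy_def minsum_def gap_def right_diff_distrib sum_subtractf)
    finally show ?thesis using that by (simp add: configs_def)
  qed
  have "real (t m \<alpha>) - real (t m' \<alpha>) = 0"
  proof (rule cartan_injective[OF cartan _ \<open>\<alpha> \<in> {1..r}\<close>])
    fix \<alpha> assume "\<alpha> \<in> {1..r}"
    have "(\<Sum>\<beta>=1..r. of_int (C \<alpha> \<beta>) * (real (t m \<beta>) - real (t m' \<beta>)))
        = of_int ((\<Sum>\<beta>=1..r. C \<alpha> \<beta> * int (t m \<beta>)) - (\<Sum>\<beta>=1..r. C \<alpha> \<beta> * int (t m' \<beta>)))"
      by (simp add: sum_subtractf algebra_simps)
    then show "(\<Sum>\<beta>=1..r. of_int (C \<alpha> \<beta>) * (real (t m \<beta>) - real (t m' \<beta>))) = 0"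
      unfolding charge[OF m \<open>\<alpha> \<in> {1..r}\<close>] charge[OF m' \<open>\<alpha> \<in> {1..r}\<close>] by simp
  qed
  then have "t m \<alpha> = t m' \<alpha>" by simp
  then show ?thesis by (simp only: t_def)
qed

lemma finite_configs: "finite (configs k l n)"
proof (cases "configs k l n = {}")
  case False
  then obtain m0 where m0: "m0 \<in> configs k l n" by blast
  define b where "b = (\<Sum>\<alpha>=1..r. \<Sum>j=1..k. j * m0 \<alpha> j)"
  have le: "m \<alpha> i \<le> b" if m: "m \<in> configs k l n" for m \<alpha> i
  proof (cases "\<alpha> \<in> {1..r} \<and> i \<in> {1..k}")
    case True
    have "m \<alpha> i \<le> i * m \<alpha> i" using True by simp
    also have "\<dots> \<le> (\<Sum>j=1..k. j * m \<alpha> j)"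
      by (rule member_le_sum[of i "{1..k}" "\<lambda>j. j * m \<alpha> j"]) (use True in auto)
    also have "\<dots> = (\<Sum>j=1..k. j * m0 \<alpha> j)" using charge_determined[OF m m0] True by blast
    also have "\<dots> \<le> b"
      unfolding b_def
      by (rule member_le_sum[of \<alpha> "{1..r}" "\<lambda>\<alpha>. \<Sum>j=1..k. j * m0 \<alpha> j"]) (use True in auto)
    finally show ?thesis .
  qed (use m in \<open>auto simp: configs_def\<close>)
  define F where "F = {f :: nat \<times> nat \<Rightarrow> nat.
    \<forall>x. (x \<in> {1..r} \<times> {1..k} \<longrightarrow> f x \<in> {..b}) \<and> (x \<notin> {1..r} \<times> {1..k} \<longrightarrow> f x = 0)}"
  have "finite F"
    unfolding F_def by (rule finite_set_of_finite_funs) auto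
  moreover have "configs k l n \<subseteq> curry ` F"
  proof
    fix m assume m: "m \<in> configs k l n"
    then have "case_prod m \<in> F"
      using le[OF m] by (auto simp: F_def configs_def)
    then show "m \<in> curry ` F" by (metis curry_case_prod image_eqI)
  qed
  ultimately show ?thesis by (meson finite_imageI finite_subset)
qed simp

subsection \<open>The quantum Q-system\<close>

lemma minsum_neighbour_vec:
  assumes "i \<le> k"
  shows "minsum k (neighbour_vec \<alpha> i \<beta>) j = (if \<beta> \<in> neighbours \<alpha> then int (min j i) else 0)"
proof -
  have "neighbour_vec \<alpha> i \<beta> = (if \<beta> \<in> neighbours \<alpha> then unit_vec \<beta> i \<beta> else (\<lambda>_. 0))"
    by (auto simp: neighbour_vec_apply unit_vec_def)
  then show ?thesis using minsum_unit_vec[OF assms, of \<beta> \<beta> j] by (simp add: minsum_def)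
qed

lemma vacancy_add: "vacancy k m (n + x) \<alpha> i = vacancy k m n \<alpha> i + minsum k (x \<alpha>) i"
proof -
  have "gap m (n + x) \<alpha> = gap m n \<alpha> + x \<alpha>"
    by (auto simp: gap_def)
  then show ?thesis by (simp add: vacancy_def minsum_add)
qed

definition bump :: "nat \<Rightarrow> nat \<Rightarrow> (nat \<Rightarrow> nat \<Rightarrow> nat) \<Rightarrow> nat \<Rightarrow> nat \<Rightarrow> nat" where
  "bump \<alpha> i m \<beta> j = m \<beta> j + (if \<beta> = \<alpha> \<and> j = i then 1 else 0)"

text \<open>The added unit subtracts column \<alpha> of C from the gaps at i, and twice the unit
  vector minus that column is the indicator of the neighbours.\<close>

lemma vacancy_bump:
  assumes "\<alpha> \<in> {1..r}" "\<beta> \<in> {1..r}"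
  shows "vacancy k (bump \<alpha> i m) (n + unit_vec \<alpha> i + unit_vec \<alpha> i) \<beta> j
    = vacancy k m (n + neighbour_vec \<alpha> i) \<beta> j"
proof -
  have "gap (bump \<alpha> i m) (n + unit_vec \<alpha> i + unit_vec \<alpha> i) \<beta> j
      = gap m (n + neighbour_vec \<alpha> i) \<beta> j" for j
  proof -
    have "(\<Sum>\<gamma>=1..r. C \<beta> \<gamma> * int (bump \<alpha> i m \<gamma> j))
        = (\<Sum>\<gamma>=1..r. C \<beta> \<gamma> * int (m \<gamma> j) + (if \<gamma> = \<alpha> then if j = i then C \<beta> \<alpha> else 0 else 0))"
      by (rule sum.cong) (auto simp: bump_def algebra_simps)
    also have "\<dots> = (\<Sum>\<gamma>=1..r. C \<beta> \<gamma> * int (m \<gamma> j)) + (if j = i then C \<alpha> \<beta> else 0)"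
      using assms C_sym[of \<alpha> \<beta>] by (simp add: sum.distrib)
    finally show ?thesis
      using assms neighbours_irrefl[of \<alpha>]
      by (auto simp: gap_def neighbour_vec_apply unit_vec_def C_eq)
  qed
  then show ?thesis by (simp add: vacancy_def minsum_def)
qed

text \<open>The vacancies of the first two sums differ only at (\<alpha>, i), by one, so
  \<open>qbinom_pascal'\<close> splits that single factor. Its second term becomes the last sum once
  a unit is removed from \<open>m \<alpha> i\<close>.\<close>

lemma fsum_recursion:
  assumes \<alpha>: "\<alpha> \<in> {1..r}" and i: "1 \<le> i" "i < k"
  shows "fsum k l (n + unit_vec \<alpha> i + unit_vec \<alpha> i)
    = fsum k l (n + unit_vec \<alpha> (i - 1) + unit_vec \<alpha> (i + 1))
      + qpow (- (minsum k (n \<alpha>) i + int i)) * fsum k l (n + neighbour_vec \<alpha> i)"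
proof -
  define n1 where "n1 = n + unit_vec \<alpha> i + unit_vec \<alpha> i"
  define n2 where "n2 = n + unit_vec \<alpha> (i - 1) + unit_vec \<alpha> (i + 1)"
  define n3 where "n3 = n + neighbour_vec \<alpha> i"
  define w where "w = minsum k (n \<alpha>) i"
  let ?\<delta> = "\<lambda>\<beta> j. if \<beta> = \<alpha> \<and> j = i then 1 else 0 :: int"
  have le: "i - 1 \<le> k" "i \<le> k" "i + 1 \<le> k" using i by auto
  note shift = plus_fun_apply minsum_add vacancy_add minsum_unit_vec[OF le(1)]
    minsum_unit_vec[OF le(2)] minsum_unit_vec[OF le(3)] minsum_neighbour_vec[OF le(2)]
  have minsum2: "minsum k (n2 \<beta>) j = minsum k (n1 \<beta>) j - ?\<delta> \<beta> j" for \<beta> j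
    unfolding n1_def n2_def shift using i by (auto simp: min_def)
  have vac2: "vacancy k m n2 \<beta> j = vacancy k m n1 \<beta> j - ?\<delta> \<beta> j" for m \<beta> j
    unfolding n1_def n2_def shift using i by (auto simp: min_def)
  have configs2: "configs k l n2 = configs k l n1"
    using i by (auto simp: configs_def vac2)
  have vac3: "vacancy k (bump \<alpha> i m) n1 \<beta> j = vacancy k m n3 \<beta> j" if "\<beta> \<in> {1..r}" for m \<beta> j
    unfolding n1_def n3_def using vacancy_bump[OF \<alpha> that] .
  have delta: "(\<Sum>\<beta>=1..r. \<Sum>j=1..k. f \<beta> j * ?\<delta> \<beta> j) = f \<alpha> i" for f
  proof -
    have "(\<Sum>\<beta>=1..r. \<Sum>j=1..k. f \<beta> j * ?\<delta> \<beta> j)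
        = (\<Sum>\<beta>=1..r. if \<beta> = \<alpha> then f \<alpha> i else 0)"
      using i by (intro sum.cong) (auto simp: if_distrib cong: if_cong)
    then show ?thesis using \<alpha> i by simp
  qed
  \<comment> \<open>The vacancy and the linear part both drop by one at (\<alpha>, i); this supplies
    the power of q in \<open>qbinom_pascal'\<close>.\<close>
  have energy2: "energy k m n1 = energy k m n2 + 2 * int (m \<alpha> i)" for m
  proof -
    have "energy k m n1 = (\<Sum>\<beta>=1..r. \<Sum>j=1..k. int (m \<beta> j) * (vacancy k m n2 \<beta> j + minsum k (n2 \<beta>) j)
        + (2 * int (m \<beta> j)) * ?\<delta> \<beta> j)"
      unfolding energy_def by (intro sum.cong refl) (auto simp: minsum2 vac2 algebra_simps)
    also have "\<dots> = energy k m n2 + 2 * int (m \<alpha> i)"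
      by (simp only: sum.distrib delta energy_def)
    finally show ?thesis .
  qed
  have minsum3: "minsum k (n1 \<beta>) j = minsum k (n3 \<beta>) j + C \<alpha> \<beta> * int (min i j)"
    if "\<beta> \<in> {1..r}" for \<beta> j
    unfolding n1_def n3_def shift using i \<alpha> that neighbours_irrefl[OF \<alpha>]
    by (auto simp: C_eq min.commute)
  \<comment> \<open>The cross terms with C coming from \<open>minsum3\<close> cancel the vacancy of
    the added unit, so the shift does not depend on m.\<close>
  have energy3: "energy k (bump \<alpha> i m) n1 = energy k m n3 + 2 * (w + int i)" for m
  proof -
    have "energy k (bump \<alpha> i m) n1
        = (\<Sum>\<beta>=1..r. \<Sum>j=1..k. int (m \<beta> j) * (vacancy k m n3 \<beta> j + minsum k (n3 \<beta>) j)
          + int (min i j) * (C \<alpha> \<beta> * int (m \<beta> j))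
          + (vacancy k m n3 \<beta> j + minsum k (n1 \<beta>) j) * ?\<delta> \<beta> j)"
      unfolding energy_def
      by (intro sum.cong refl) (auto simp: vac3 minsum3 bump_def algebra_simps)
    also have "\<dots> = energy k m n3 + (\<Sum>\<beta>=1..r. \<Sum>j=1..k. int (min i j) * (C \<alpha> \<beta> * int (m \<beta> j)))
        + (vacancy k m n3 \<alpha> i + minsum k (n1 \<alpha>) i)"
      by (simp only: sum.distrib delta energy_def)
    also have "(\<Sum>\<beta>=1..r. \<Sum>j=1..k. int (min i j) * (C \<alpha> \<beta> * int (m \<beta> j)))
        = (\<Sum>j=1..k. int (min i j) * (\<Sum>\<beta>=1..r. C \<alpha> \<beta> * int (m \<beta> j)))"
      by (subst sum.swap) (simp add: sum_distrib_left)
    also have "\<dots> = minsum k (n3 \<alpha>) i - vacancy k m n3 \<alpha> i"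
      by (simp add: vacancy_def minsum_def gap_def right_diff_distrib sum_subtractf)
    finally have "energy k (bump \<alpha> i m) n1
        = energy k m n3 + minsum k (n3 \<alpha>) i + minsum k (n1 \<alpha>) i" by simp
    moreover have "minsum k (n1 \<alpha>) i = w + 2 * int i"
      unfolding n1_def w_def shift by simp
    moreover have "minsum k (n3 \<alpha>) i = w"
      unfolding n3_def w_def shift using neighbours_irrefl[OF \<alpha>] by simp
    ultimately show ?thesis by simp
  qed
  let ?X = "{1..r} \<times> {1..k}"
  let ?Y = "?X - {(\<alpha>, i)}"
  let ?fac = "\<lambda>m n x. qbinom (m (fst x) (snd x)) (vacancy k m n (fst x) (snd x))"
  have split: "weight k m n = qpow (- (energy k m n div 2)) *
      (qbinom (m \<alpha> i) (vacancy k m n \<alpha> i) * (\<Prod>x\<in>?Y. ?fac m n x))" for m n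
    unfolding weight_def using \<alpha> i by (subst prod.remove[of ?X "(\<alpha>, i)"]) auto
  have fac2: "(\<Prod>x\<in>?Y. ?fac m n2 x) = (\<Prod>x\<in>?Y. ?fac m n1 x)" for m
    by (rule prod.cong) (auto simp: vac2)
  have fac3: "(\<Prod>x\<in>?Y. ?fac m n3 x) = (\<Prod>x\<in>?Y. ?fac (bump \<alpha> i m) n1 x)" for m
    by (rule prod.cong) (auto simp: vac3 bump_def)
  have weight0: "weight k m n1 = weight k m n2" if "m \<alpha> i = 0" for m
    unfolding split fac2 using that by (simp add: energy2 qbinom_0)
  have weight1: "weight k (bump \<alpha> i m) n1
      = weight k (bump \<alpha> i m) n2 + qpow (- (w + int i)) * weight k m n3" for m
  proof -
    define a p where "a = m \<alpha> i" and "p = vacancy k m n3 \<alpha> i"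
    define R where "R = (\<Prod>x\<in>?Y. ?fac m n3 x)"
    have Rb: "(\<Prod>x\<in>?Y. ?fac (bump \<alpha> i m) n1 x) = R" by (simp only: R_def fac3)
    define h where "h = - (energy k (bump \<alpha> i m) n1 div 2)"
    have m': "bump \<alpha> i m \<alpha> i = Suc a" by (simp add: bump_def a_def)
    have w1: "weight k (bump \<alpha> i m) n1 = qpow h * (qbinom (Suc a) p * R)"
      by (simp only: split m' Rb h_def p_def vac3[OF \<alpha>])
    have "- (energy k (bump \<alpha> i m) n2 div 2) = h + int (Suc a)"
      using energy2[of "bump \<alpha> i m"] by (simp add: h_def m')
    then have w2: "weight k (bump \<alpha> i m) n2
        = qpow h * (qpow (int (Suc a)) * qbinom (Suc a) (p - 1) * R)"
      unfolding split fac2 Rb unfolding m' vac2 vac3[OF \<alpha>] p_def by (simp add: qpow_add mult.assoc)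
    have "- (energy k m n3 div 2) = h + (w + int i)"
      using energy3[of m] by (simp add: h_def)
    then have w3: "weight k m n3 = qpow (h + (w + int i)) * (qbinom a p * R)"
      by (simp only: split R_def a_def p_def)
    have "qpow (- (w + int i)) * qpow (h + (w + int i)) = qpow h"
      by (simp flip: qpow_add)
    then have "qpow (- (w + int i)) * weight k m n3 = qpow h * (qbinom a p * R)"
      unfolding w3 by (simp only: mult.assoc[symmetric])
    then show ?thesis
      unfolding w1 w2 qbinom_pascal'[of a p] by (simp only: distrib_left distrib_right)
  qed
  define S where "S = {m \<in> configs k l n1. m \<alpha> i \<noteq> 0}"
  define unbump where "unbump m = (\<lambda>\<beta> j. m \<beta> j - (if \<beta> = \<alpha> \<and> j = i then 1 else 0))"
    for m :: "nat \<Rightarrow> nat \<Rightarrow> nat"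
  have unbump_bump: "unbump (bump \<alpha> i m) = m" for m
    by (auto simp: unbump_def bump_def fun_eq_iff)
  have bump_unbump: "bump \<alpha> i (unbump m) = m" if "m \<alpha> i \<noteq> 0" for m
    using that by (auto simp: unbump_def bump_def fun_eq_iff)
  have bump_mem: "bump \<alpha> i m \<in> S \<longleftrightarrow> m \<in> configs k l n3" for m
    using \<alpha> i vac3 by (auto simp: S_def configs_def bump_def split: if_splits)
  have fin: "finite (configs k l n1)" by (rule finite_configs)
  have "fsum k l n1 = (\<Sum>m\<in>configs k l n1. weight k m n2
      + (if m \<alpha> i \<noteq> 0 then qpow (- (w + int i)) * weight k (unbump m) n3 else 0))"
    unfolding fsum_def
  proof (rule sum.cong)
    fix m
    show "weight k m n1 = weight k m n2
        + (if m \<alpha> i \<noteq> 0 then qpow (- (w + int i)) * weight k (unbump m) n3 else 0)"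
      using weight0[of m] weight1[of "unbump m"] bump_unbump[of m] by auto
  qed simp
  also have "\<dots> = fsum k l n2 + (\<Sum>m\<in>S. qpow (- (w + int i)) * weight k (unbump m) n3)"
    unfolding fsum_def configs2 S_def sum.distrib using fin by (simp only: sum.inter_filter)
  also have "(\<Sum>m\<in>S. qpow (- (w + int i)) * weight k (unbump m) n3)
      = (\<Sum>m\<in>configs k l n3. qpow (- (w + int i)) * weight k m n3)"
  proof (rule sum.reindex_bij_witness[of _ "bump \<alpha> i" unbump])
    fix m assume "m \<in> S"
    then show "bump \<alpha> i (unbump m) = m" by (simp add: S_def bump_unbump)
    then show "unbump m \<in> configs k l n3" using \<open>m \<in> S\<close> bump_mem[of "unbump m"] by simp
  qed (auto simp: bump_mem unbump_bump)
  also have "\<dots> = qpow (- (w + int i)) * fsum k l n3"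
    by (simp add: fsum_def sum_distrib_left)
  finally show ?thesis unfolding n1_def n2_def n3_def w_def .
qed

definition tail :: "nat \<Rightarrow> (nat \<Rightarrow> nat \<Rightarrow> nat) \<Rightarrow> nat \<Rightarrow> nat \<Rightarrow> nat" where
  "tail j m \<alpha> i = (if j < i then m \<alpha> i else 0)"

lemma tail_eqD: "tail j m = tail j m' \<Longrightarrow> j < i \<Longrightarrow> m \<alpha> i = m' \<alpha> i"
  by (metis tail_def)

subsection \<open>Fixing the tail of the summation vector\<close>

lemma configs_support:
  "m \<in> configs k l n \<Longrightarrow> m \<alpha> i \<noteq> 0 \<Longrightarrow> \<alpha> \<in> {1..r} \<and> i \<in> {1..k}"
  unfolding configs_def by (simp only: mem_Collect_eq) metis

lemma weight_eq_0:
  assumes "m \<in> configs k l n" "m \<alpha> i \<noteq> 0" "vacancy k m n \<alpha> i = -1"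
  shows "weight k m n = 0"
proof -
  have "(\<Prod>x\<in>{1..r} \<times> {1..k}. qbinom (m (fst x) (snd x)) (vacancy k m n (fst x) (snd x))) = 0"
    by (rule prod_zero[OF _ bexI[of _ "(\<alpha>, i)"]])
      (use assms configs_support[OF assms(1,2)] in \<open>auto simp: qbinom_minus_one\<close>)
  then show ?thesis by (simp add: weight_def)
qed

text \<open>Differences of vacancies from j on involve only gaps beyond j, and the value at k is
  prescribed by \<open>configs\<close>.\<close>

lemma vacancy_tail_cong:
  assumes m: "m \<in> configs k l n" and m0: "m0 \<in> configs k l n" and "tail j m = tail j m0"
    and "j \<le> i" "j \<le> k" "\<alpha> \<in> {1..r}"
  shows "vacancy k m n \<alpha> i = vacancy k m0 n \<alpha> i"
proof -
  have "gap m n \<alpha> x = gap m0 n \<alpha> x" if "j < x" for x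
    using tail_eqD[OF assms(3) that] by (simp add: gap_def)
  then have "vacancy k m n \<alpha> x - vacancy k m n \<alpha> j = vacancy k m0 n \<alpha> x - vacancy k m0 n \<alpha> j"
    if "j \<le> x" for x
    unfolding vacancy_def by (rule minsum_diff_cong[OF that])
  from this[OF \<open>j \<le> i\<close>] this[OF \<open>j \<le> k\<close>] show ?thesis
    using m m0 \<open>\<alpha> \<in> {1..r}\<close> by (simp add: configs_def)
qed

text \<open>
  In terms of exponents, a partial sum with \<open>p\<^sub>j\<^sub>+\<^sub>1 = a\<close> and \<open>p\<^sub>j = b\<close> is the constant term attached to
  \<open>Q\<^sub>1\<close> to the \<open>n\<^sub>1\<close>, \<open>\<dots>\<close>, \<open>Q\<^sub>j\<close> to the \<open>n\<^sub>j + a + 1\<close>, \<open>Q\<^sub>j\<^sub>+\<^sub>1\<close> to the \<open>-b - 1\<close>; the value \<open>l = -1\<close> at level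
  \<open>j + 1\<close> forces \<open>m\<^sub>j\<^sub>+\<^sub>1 = 0\<close>.
\<close>

definition tail_params :: "nat \<Rightarrow> nat \<Rightarrow> (nat \<Rightarrow> nat \<Rightarrow> nat) \<Rightarrow> (nat \<Rightarrow> nat \<Rightarrow> int) \<Rightarrow> nat \<Rightarrow> nat \<Rightarrow> int" where
  "tail_params k j m n \<alpha> i =
     (if i < j then n \<alpha> i
      else if i = j then n \<alpha> j + vacancy k m n \<alpha> (Suc j) + 1
      else - vacancy k m n \<alpha> j - 1)"

text \<open>Entries up to j feel the tail only through the slope a - b of the vacancies from j to j
  + 1. The added exponents a + 1 and -b - 1 have this total, and they turn the vacancy at j + 1 into
  \<open>p\<^sub>j - b - 1\<close>, so that the value -1 says \<open>p\<^sub>j = b\<close>.\<close>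

lemma fsum_tail:
  assumes m0: "m0 \<in> configs k l n" and j: "1 \<le> j" "j < k"
  shows "\<exists>K. (\<Sum>m | m \<in> configs k l n \<and> tail j m = tail j m0. weight k m n)
    = K * fsum (Suc j) (\<lambda>_. -1) (tail_params k j m0 n)"
proof -
  define \<nu> where "\<nu> = tail_params k j m0 n"
  define T where "T = {m. m \<in> configs k l n \<and> tail j m = tail j m0}"
  define head where "head m \<alpha> i = (if i \<le> j then m \<alpha> i else 0)" for m :: "nat \<Rightarrow> nat \<Rightarrow> nat" and \<alpha> i
  define join where "join m \<alpha> i = (if i \<le> j then m \<alpha> i else m0 \<alpha> i)" for m :: "nat \<Rightarrow> nat \<Rightarrow> nat" and \<alpha> i
  define a where "a \<alpha> = vacancy k m0 n \<alpha> (Suc j)" for \<alpha>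
  define b where "b \<alpha> = vacancy k m0 n \<alpha> j" for \<alpha>
  have Tm: "m \<in> configs k l n" "tail j m = tail j m0" "\<And>\<alpha> i. j < i \<Longrightarrow> m \<alpha> i = m0 \<alpha> i"
    if "m \<in> T" for m
    using that tail_eqD[of j m m0] by (auto simp: T_def)
  \<comment> \<open>For i \<le> j all positions from j on carry the same coefficient i, so only
    their total matters.\<close>
  have minsum_low: "minsum (Suc j) f i = minsum k g i"
    if "i \<le> j" "\<And>x. x \<in> {1..<j} \<Longrightarrow> f x = g x"
      "f j + f (Suc j) = g j + (\<Sum>x\<in>{j<..k}. g x)" for f g i
  proof -
    have "{j<..Suc j} = {Suc j}" "{1..j} = insert j {1..<j}" using j by auto
    then have "minsum (Suc j) f i = (\<Sum>x\<in>{1..<j}. int (min i x) * f x) + int i * (f j + f (Suc j))"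
      using that(1) minsum_split[of j "Suc j" i f] by (simp add: minsum_def distrib_left)
    also have "(\<Sum>x\<in>{1..<j}. int (min i x) * f x) = (\<Sum>x\<in>{1..<j}. int (min i x) * g x)"
      by (rule sum.cong) (use that(2) in auto)
    also have "\<dots> + int i * (f j + f (Suc j)) = minsum k g i"
      using \<open>{1..j} = insert j {1..<j}\<close> that(1,3) minsum_split[of j k i g] j
      by (simp add: minsum_def distrib_left)
    finally show ?thesis .
  qed
  have vac_step: "a \<alpha> = b \<alpha> + (\<Sum>x\<in>{j<..k}. gap m0 n \<alpha> x)" for \<alpha>
    using minsum_Suc_diff[OF j(2)] by (simp add: a_def b_def vacancy_def)
  have gap_head: "gap (head m) \<nu> \<alpha> x = (if x < j then gap m n \<alpha> x
      else if x = j then gap m n \<alpha> j + a \<alpha> + 1 else - b \<alpha> - 1)" for m \<alpha> x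
    by (auto simp: gap_def head_def \<nu>_def tail_params_def a_def b_def)
  have vac_low: "vacancy (Suc j) (head m) \<nu> \<alpha> i = vacancy k m n \<alpha> i"
    if "i \<le> j" "\<And>\<alpha> i. j < i \<Longrightarrow> m \<alpha> i = m0 \<alpha> i" for m \<alpha> i
    unfolding vacancy_def
  proof (rule minsum_low[OF that(1)])
    have "(\<Sum>x\<in>{j<..k}. gap m n \<alpha> x) = (\<Sum>x\<in>{j<..k}. gap m0 n \<alpha> x)"
      by (rule sum.cong) (auto simp: gap_def that(2))
    then show "gap (head m) \<nu> \<alpha> j + gap (head m) \<nu> \<alpha> (Suc j)
        = gap m n \<alpha> j + (\<Sum>x\<in>{j<..k}. gap m n \<alpha> x)"
      using vac_step[of \<alpha>] by (simp add: gap_head)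
  qed (simp add: gap_head)
  have vac_top: "vacancy (Suc j) (head m) \<nu> \<alpha> (Suc j) = vacancy k m n \<alpha> j - b \<alpha> - 1"
    if "\<And>\<alpha> i. j < i \<Longrightarrow> m \<alpha> i = m0 \<alpha> i" for m \<alpha>
  proof -
    have "{j<..Suc j} = {Suc j}" by auto
    then show ?thesis
      using minsum_Suc_diff[of j "Suc j" "gap (head m) \<nu> \<alpha>"] vac_low[where i = j and m = m and \<alpha> = \<alpha>, OF order.refl that]
      by (simp add: vacancy_def gap_head)
  qed
  have vac_T: "vacancy k m n \<alpha> i = vacancy k m0 n \<alpha> i" if "m \<in> T" "j \<le> i" "\<alpha> \<in> {1..r}" for m \<alpha> i
    using vacancy_tail_cong[OF Tm(1)[OF that(1)] m0 Tm(2)[OF that(1)] that(2) _ that(3)] j by simp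
  have "m0 \<in> T" using m0 by (simp add: T_def)

  \<comment> \<open>The excess of the total of the old exponents from j on over the new total. It
    changes the energy by \<open>d \<alpha>\<close> times the charge of the head, which is constant
    on \<open>T\<close>.\<close>
  define d where "d \<alpha> = (\<Sum>x\<in>{j<..k}. n \<alpha> x) - (a \<alpha> - b \<alpha>)" for \<alpha>
  have minsum_n: "minsum k (n \<alpha>) i = minsum (Suc j) (\<nu> \<alpha>) i + int i * d \<alpha>" if "i \<le> j" for \<alpha> i
  proof -
    have "minsum (Suc j) (\<nu> \<alpha>) i = minsum k (\<lambda>x. n \<alpha> x - (if x = Suc j then d \<alpha> else 0)) i"
    proof (rule minsum_low[OF that])
      have "(\<Sum>x\<in>{j<..k}. n \<alpha> x - (if x = Suc j then d \<alpha> else 0)) = a \<alpha> - b \<alpha>"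
        using j by (simp add: sum_subtractf d_def)
      then show "\<nu> \<alpha> j + \<nu> \<alpha> (Suc j) = n \<alpha> j - (if j = Suc j then d \<alpha> else 0) +
          (\<Sum>x\<in>{j<..k}. n \<alpha> x - (if x = Suc j then d \<alpha> else 0))"
        by (simp add: \<nu>_def tail_params_def a_def b_def)
    qed (auto simp: \<nu>_def tail_params_def)
    also have "\<dots> = minsum k (n \<alpha>) i - (\<Sum>x=1..k. if x = Suc j then int i * d \<alpha> else 0)"
      unfolding minsum_def sum_subtractf[symmetric] using that
      by (intro sum.cong) (auto simp: algebra_simps)
    also have "(\<Sum>x=1..k. if x = Suc j then int i * d \<alpha> else 0) = int i * d \<alpha>"
      using j by simp
    finally show ?thesis by simp
  qed
  have ivl: "{1..k} = {1..j} \<union> {j<..k}" "{1..j} \<inter> {j<..k} = {}" using j by auto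
  define head_charge where "head_charge m \<alpha> = (\<Sum>i=1..j. i * m \<alpha> i)" for m :: "nat \<Rightarrow> nat \<Rightarrow> nat" and \<alpha>
  have charge: "head_charge m \<alpha> = head_charge m0 \<alpha>" if "m \<in> T" "\<alpha> \<in> {1..r}" for m \<alpha>
  proof -
    have "(\<Sum>i\<in>{j<..k}. i * m \<alpha> i) = (\<Sum>i\<in>{j<..k}. i * m0 \<alpha> i)"
      by (rule sum.cong) (auto simp: Tm(3)[OF that(1)])
    moreover have "(\<Sum>i=1..k. i * m \<alpha> i) = head_charge m \<alpha> + (\<Sum>i\<in>{j<..k}. i * m \<alpha> i)" for m
      unfolding head_charge_def ivl(1) by (rule sum.union_disjoint) (use ivl(2) in auto)
    ultimately show ?thesis
      using charge_determined[OF Tm(1)[OF that(1)] m0 that(2)] by simp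
  qed
  define c where "c = (\<Sum>\<alpha>=1..r. d \<alpha> * int (head_charge m0 \<alpha>)
    + (\<Sum>i\<in>{j<..k}. int (m0 \<alpha> i) * (vacancy k m0 n \<alpha> i + minsum k (n \<alpha>) i)))"
  have energy: "energy k m n = energy (Suc j) (head m) \<nu> + c" if "m \<in> T" for m
  proof -
    have "(\<Sum>i=1..k. int (m \<alpha> i) * (vacancy k m n \<alpha> i + minsum k (n \<alpha>) i))
        = (\<Sum>i=1..Suc j. int (head m \<alpha> i)
            * (vacancy (Suc j) (head m) \<nu> \<alpha> i + minsum (Suc j) (\<nu> \<alpha>) i))
          + (d \<alpha> * int (head_charge m0 \<alpha>)
            + (\<Sum>i\<in>{j<..k}. int (m0 \<alpha> i) * (vacancy k m0 n \<alpha> i + minsum k (n \<alpha>) i)))"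
      if "\<alpha> \<in> {1..r}" for \<alpha>
    proof -
      have "(\<Sum>i=1..j. int (m \<alpha> i) * (vacancy k m n \<alpha> i + minsum k (n \<alpha>) i))
          = (\<Sum>i=1..j. int (head m \<alpha> i)
              * (vacancy (Suc j) (head m) \<nu> \<alpha> i + minsum (Suc j) (\<nu> \<alpha>) i)
              + d \<alpha> * int (i * m \<alpha> i))"
        by (intro sum.cong refl)
          (auto simp: vac_low[OF _ Tm(3)[OF \<open>m \<in> T\<close>]] minsum_n head_def algebra_simps)
      also have "\<dots> = (\<Sum>i=1..j. int (head m \<alpha> i)
              * (vacancy (Suc j) (head m) \<nu> \<alpha> i + minsum (Suc j) (\<nu> \<alpha>) i))
              + d \<alpha> * int (head_charge m \<alpha>)"
        by (simp only: sum.distrib head_charge_def sum_distrib_left of_nat_sum)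
      also have "(\<Sum>i=1..j. int (head m \<alpha> i)
              * (vacancy (Suc j) (head m) \<nu> \<alpha> i + minsum (Suc j) (\<nu> \<alpha>) i))
          = (\<Sum>i=1..Suc j. int (head m \<alpha> i)
              * (vacancy (Suc j) (head m) \<nu> \<alpha> i + minsum (Suc j) (\<nu> \<alpha>) i))"
        by (simp add: head_def)
      moreover have "(\<Sum>i\<in>{j<..k}. int (m \<alpha> i) * (vacancy k m n \<alpha> i + minsum k (n \<alpha>) i))
          = (\<Sum>i\<in>{j<..k}. int (m0 \<alpha> i) * (vacancy k m0 n \<alpha> i + minsum k (n \<alpha>) i))"
        by (intro sum.cong refl) (use that in \<open>auto simp: Tm(3)[OF \<open>m \<in> T\<close>] vac_T[OF \<open>m \<in> T\<close>]\<close>)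
      moreover have "(\<Sum>i=1..k. int (m \<alpha> i) * (vacancy k m n \<alpha> i + minsum k (n \<alpha>) i))
          = (\<Sum>i=1..j. int (m \<alpha> i) * (vacancy k m n \<alpha> i + minsum k (n \<alpha>) i))
          + (\<Sum>i\<in>{j<..k}. int (m \<alpha> i) * (vacancy k m n \<alpha> i + minsum k (n \<alpha>) i))"
        unfolding ivl(1) by (rule sum.union_disjoint) (use ivl(2) in auto)
      ultimately show ?thesis
        using charge[OF \<open>m \<in> T\<close> that] by (simp only: add.assoc)
    qed
    then show ?thesis unfolding energy_def c_def by (simp add: sum.distrib)
  qed

  define K where "K = qpow (- (c div 2)) *
    (\<Prod>x\<in>{1..r} \<times> {j<..k}. qbinom (m0 (fst x) (snd x)) (vacancy k m0 n (fst x) (snd x)))"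
  have weight: "weight k m n = K * weight (Suc j) (head m) \<nu>" if "m \<in> T" for m
  proof -
    let ?F = "\<lambda>x. qbinom (m (fst x) (snd x)) (vacancy k m n (fst x) (snd x))"
    let ?G = "\<lambda>x. qbinom (head m (fst x) (snd x)) (vacancy (Suc j) (head m) \<nu> (fst x) (snd x))"
    \<comment> \<open>So \<open>c\<close> is even as well, and halving is additive.\<close>
    have even: "even (energy k m n)" "even (energy (Suc j) (head m) \<nu>)"
      by (rule even_energy)+
    then have "- (energy k m n div 2) = - (c div 2) + - (energy (Suc j) (head m) \<nu> div 2)"
      unfolding energy[OF that] by (auto elim!: evenE)
    moreover have "(\<Prod>x\<in>{1..r} \<times> {1..k}. ?F x)
        = (\<Prod>x\<in>{1..r} \<times> {1..j}. ?F x) * (\<Prod>x\<in>{1..r} \<times> {j<..k}. ?F x)"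
      unfolding ivl(1) Sigma_Un_distrib2 by (rule prod.union_disjoint) (use ivl(2) in auto)
    moreover have "(\<Prod>x\<in>{1..r} \<times> {1..j}. ?F x) = (\<Prod>x\<in>{1..r} \<times> {1..j}. ?G x)"
      by (rule prod.cong) (auto simp: vac_low[OF _ Tm(3)[OF that]] head_def)
    moreover have "(\<Prod>x\<in>{1..r} \<times> {j<..k}. ?F x)
        = (\<Prod>x\<in>{1..r} \<times> {j<..k}. qbinom (m0 (fst x) (snd x)) (vacancy k m0 n (fst x) (snd x)))"
      by (rule prod.cong) (auto simp: Tm(3)[OF that] vac_T[OF that])
    moreover have "(\<Prod>x\<in>{1..r} \<times> {1..j}. ?G x) = (\<Prod>x\<in>{1..r} \<times> {1..Suc j}. ?G x)"
      by (rule prod.mono_neutral_left) (auto simp: head_def qbinom_0)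
    ultimately show ?thesis
      by (simp only: weight_def K_def qpow_add mult_ac)
  qed

  let ?S = "configs (Suc j) (\<lambda>_. -1) \<nu>"
  have "(\<Sum>m\<in>T. weight k m n) = (\<Sum>m\<in>{m \<in> ?S. \<forall>\<alpha>. m \<alpha> (Suc j) = 0}. K * weight (Suc j) m \<nu>)"
  proof (rule sum.reindex_bij_witness[of _ join head])
    fix m assume m: "m \<in> T"
    show "join (head m) = m"
      using Tm(3)[OF m] by (auto simp: join_def head_def fun_eq_iff)
    show "head m \<in> {m \<in> ?S. \<forall>\<alpha>. m \<alpha> (Suc j) = 0}"
      using vac_top[OF Tm(3)[OF m]] vac_T[OF m] Tm(1)[OF m] j
      by (auto simp: configs_def b_def) (auto simp: head_def)
    show "K * weight (Suc j) (head m) \<nu> = weight k m n" using weight[OF m] ..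
  next
    fix m assume m: "m \<in> {m \<in> ?S. \<forall>\<alpha>. m \<alpha> (Suc j) = 0}"
    have supp: "m \<alpha> i = 0" if "j < i" for \<alpha> i
      using m that by (cases "i = Suc j") (auto simp: configs_def)
    show hj: "head (join m) = m"
      using supp by (auto simp: join_def head_def fun_eq_iff)
    have tail: "join m \<alpha> i = m0 \<alpha> i" if "j < i" for \<alpha> i
      using that by (simp add: join_def)
    have "vacancy k (join m) n \<alpha> k = l \<alpha>" if "\<alpha> \<in> {1..r}" for \<alpha>
    proof -
      have "vacancy k (join m) n \<alpha> j = b \<alpha>"
        using vac_top[of "join m" \<alpha>, OF tail] m that by (simp add: hj configs_def)
      moreover have "vacancy k (join m) n \<alpha> k - vacancy k (join m) n \<alpha> j
          = vacancy k m0 n \<alpha> k - vacancy k m0 n \<alpha> j"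
        unfolding vacancy_def using j by (intro minsum_diff_cong) (auto simp: gap_def tail)
      ultimately show ?thesis using m0 that by (simp add: b_def configs_def)
    qed
    moreover have "join m \<alpha> i = 0" if "\<alpha> \<notin> {1..r} \<or> i \<notin> {1..k}" for \<alpha> i
      using that m m0 j by (auto simp: join_def configs_def)
    ultimately show "join m \<in> T"
      by (auto simp: T_def configs_def tail_def fun_eq_iff tail)
  qed
  \<comment> \<open>A nonzero \<open>m \<alpha> (Suc j)\<close> meets the vacancy -1, so the added
    terms are zero.\<close>
  also have "\<dots> = (\<Sum>m\<in>?S. K * weight (Suc j) m \<nu>)"
  proof (rule sum.mono_neutral_left)
    show "\<forall>m\<in>?S - {m \<in> ?S. \<forall>\<alpha>. m \<alpha> (Suc j) = 0}. K * weight (Suc j) m \<nu> = 0"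
    proof
      fix m assume m: "m \<in> ?S - {m \<in> ?S. \<forall>\<alpha>. m \<alpha> (Suc j) = 0}"
      then obtain \<alpha> where \<alpha>: "m \<alpha> (Suc j) \<noteq> 0" by auto
      with m have "\<alpha> \<in> {1..r}" using configs_support by blast
      with m have "vacancy (Suc j) m \<nu> \<alpha> (Suc j) = -1" by (auto simp: configs_def)
      with m \<alpha> have "weight (Suc j) m \<nu> = 0" using weight_eq_0 by blast
      then show "K * weight (Suc j) m \<nu> = 0" by simp
    qed
  qed (auto simp: finite_configs)
  also have "\<dots> = K * fsum (Suc j) (\<lambda>_. -1) \<nu>"
    by (simp add: fsum_def sum_distrib_left)
  finally show ?thesis unfolding T_def \<nu>_def by blast
qed

subsection \<open>Vanishing at nonnegative exponents\<close>

lemma sum_eq_0_by_tails: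
  assumes "finite A" "\<And>m0. m0 \<in> A \<Longrightarrow> (\<Sum>m | m \<in> A \<and> tail j m = tail j m0. f m) = (0 :: laurent_poly)"
  shows "sum f A = 0"
  unfolding sum.image_gen[OF assms(1), of f "tail j"] by (rule sum.neutral) (use assms(2) in auto)

lemma fsum_cong:
  assumes "\<And>\<beta> j. \<beta> \<in> {1..r} \<Longrightarrow> j \<in> {1..k} \<Longrightarrow> n \<beta> j = n' \<beta> j"
  shows "fsum k l n = fsum k l n'"
proof -
  have ms: "minsum k (n \<beta>) i = minsum k (n' \<beta>) i" if "\<beta> \<in> {1..r}" for \<beta> i
    by (rule minsum_cong) (use assms that in auto)
  have vac: "vacancy k m n \<beta> i = vacancy k m n' \<beta> i" if "\<beta> \<in> {1..r}" for m \<beta> i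
    unfolding vacancy_def by (rule minsum_cong) (use assms that in \<open>auto simp: gap_def\<close>)
  have "configs k l n = configs k l n'"
    by (auto simp: configs_def vac)
  moreover have "weight k m n = weight k m n'" for m
  proof -
    have "energy k m n = energy k m n'"
      unfolding energy_def by (intro sum.cong refl) (simp add: ms vac)
    moreover have "(\<Prod>x\<in>{1..r} \<times> {1..k}. qbinom (m (fst x) (snd x)) (vacancy k m n (fst x) (snd x)))
        = (\<Prod>x\<in>{1..r} \<times> {1..k}. qbinom (m (fst x) (snd x)) (vacancy k m n' (fst x) (snd x)))"
      by (rule prod.cong) (auto simp: vac)
    ultimately show ?thesis by (simp only: weight_def)
  qed
  ultimately show ?thesis by (simp add: fsum_def)
qed

text \<open>Other nodes may carry any integers. The top exponent t is the measure of the inner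
  induction in \<open>fsum_vanish\<close>.\<close>

definition nonneg_at :: "nat \<Rightarrow> nat \<Rightarrow> nat \<Rightarrow> (nat \<Rightarrow> nat \<Rightarrow> int) \<Rightarrow> bool" where
  "nonneg_at J t \<alpha> n \<longleftrightarrow> (\<forall>i\<in>{1..J}. n \<alpha> i \<ge> 0) \<and> n \<alpha> J = int t"

text \<open>All top vacancies are -1, so only terms without top entries survive. Top exponent 0 then
  gives vacancy -1 at (\<alpha>, j + 1), which kills the entry there as well. The gap left at that
  position comes from n and the neighbours and is nonnegative, so the vacancy at (\<alpha>, j) is
  negative and \<open>fsum_tail\<close> lowers the level.\<close>

lemma fsum_top_zero:
  assumes \<alpha>: "\<alpha> \<in> {1..r}" and good: "nonneg_at (Suc (Suc j)) 0 \<alpha> n"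
    and IH: "\<And>n'. 1 \<le> j \<Longrightarrow> \<forall>i\<in>{1..Suc j}. n' \<alpha> i \<ge> 0 \<Longrightarrow> fsum (Suc j) (\<lambda>_. -1) n' = 0"
  shows "fsum (Suc (Suc j)) (\<lambda>_. -1) n = 0"
  unfolding fsum_def
proof (rule sum_eq_0_by_tails[OF finite_configs, where j = j])
  let ?J = "Suc (Suc j)"
  let ?A = "configs ?J (\<lambda>_. -1) n"
  fix m0 assume m0: "m0 \<in> ?A"
  let ?T = "{m. m \<in> ?A \<and> tail j m = tail j m0}"
  have kill: "(\<Sum>m\<in>?T. weight ?J m n) = 0"
    if "j < i" "m0 \<beta> i \<noteq> 0" "vacancy ?J m0 n \<beta> i = -1" for \<beta> i
  proof (rule sum.neutral, rule ballI)
    fix m assume m: "m \<in> ?T"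
    then have "m \<beta> i = m0 \<beta> i" using tail_eqD[of j m m0 i \<beta>] \<open>j < i\<close> by simp
    moreover have "vacancy ?J m n \<beta> i = vacancy ?J m0 n \<beta> i"
      using vacancy_tail_cong[OF _ m0, of m j i \<beta>] m \<open>j < i\<close> configs_support[OF m0 that(2)] by simp
    ultimately show "weight ?J m n = 0"
      using weight_eq_0[of m ?J "\<lambda>_. -1" n \<beta> i] m that(2,3) by simp
  qed
  have top: "vacancy ?J m0 n \<beta> ?J = -1" if "\<beta> \<in> {1..r}" for \<beta>
    using m0 that by (simp add: configs_def)
  show "(\<Sum>m\<in>?T. weight ?J m n) = 0"
  proof (cases "\<forall>\<beta>. m0 \<beta> ?J = 0")
    case False
    then obtain \<beta> where "m0 \<beta> ?J \<noteq> 0" by blast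
    then show ?thesis using kill[of ?J \<beta>] top configs_support[OF m0] by simp
  next
    case m_top: True
    have v1: "vacancy ?J m0 n \<alpha> (Suc j) = -1"
    proof -
      have "{Suc j<..?J} = {?J}" by auto
      then show ?thesis
        using minsum_Suc_diff[of "Suc j" ?J "gap m0 n \<alpha>"] top[OF \<alpha>] m_top good
        by (simp add: vacancy_def gap_def nonneg_at_def)
    qed
    show ?thesis
    proof (cases "m0 \<alpha> (Suc j) = 0")
      case False
      then show ?thesis using kill[of "Suc j" \<alpha>] v1 by simp
    next
      case True
      have "(\<Sum>\<beta>=1..r. C \<alpha> \<beta> * int (m0 \<beta> (Suc j))) \<le> 0"
        using True C_eq[OF \<alpha>] by (intro sum_nonpos) (auto simp: mult_nonpos_nonneg)
      moreover have "n \<alpha> (Suc j) \<ge> 0" using good by (simp add: nonneg_at_def)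
      ultimately have "gap m0 n \<alpha> (Suc j) \<ge> 0" by (simp add: gap_def)
      then have v0: "vacancy ?J m0 n \<alpha> j < 0"
        using minsum_second_difference[of j ?J "gap m0 n \<alpha>"] v1 top[OF \<alpha>]
        by (simp add: vacancy_def)
      \<comment> \<open>The vacancy at index 0 is 0, which excludes j = 0.\<close>
      then have "1 \<le> j"
        by (cases j) (auto simp: vacancy_def)
      \<comment> \<open>At \<alpha> the new exponents are \<open>n\<^sub>j - 1 + 1\<close> at j and
        \<open>-p\<^sub>j - 1 \<ge> 0\<close> at j + 1.\<close>
      have "fsum (Suc j) (\<lambda>_. -1) (tail_params ?J j m0 n) = 0"
        using good v0 v1 \<open>1 \<le> j\<close>
        by (intro IH) (auto simp: tail_params_def nonneg_at_def)
      then show ?thesis using fsum_tail[OF m0 \<open>1 \<le> j\<close>] by auto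
    qed
  qed
qed

lemma nonneg_at_neighbour:
  assumes "\<alpha> \<in> {1..r}"
  shows "nonneg_at J t \<alpha> (n + neighbour_vec \<alpha> i) \<longleftrightarrow> nonneg_at J t \<alpha> n"
  using neighbours_irrefl[OF assms] by (simp add: nonneg_at_def neighbour_vec_apply)

text \<open>Where the exponents at \<open>\<alpha>\<close> may drop to \<open>-1\<close> in position \<open>i\<close>, the two-step relations of the
  neighbours still apply, since their remainder terms raise that exponent by one.\<close>

lemma fsum_exchange_neighbours:
  assumes \<alpha>: "\<alpha> \<in> {1..r}" and i: "1 \<le> i" "i < J"
    and vanish: "\<And>n. nonneg_at J t \<alpha> n \<Longrightarrow> fsum J l n = 0"
    and F: "finite F" "F \<subseteq> neighbours \<alpha>"
    and n: "nonneg_at J t \<alpha> (n + unit_vec \<alpha> i)"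
  shows "fsum J l (n + (\<Sum>\<beta>\<in>F. unit_vec \<beta> (i - 1)) + (\<Sum>\<beta>\<in>F. unit_vec \<beta> (i + 1)))
    = fsum J l (n + (\<Sum>\<beta>\<in>F. unit_vec \<beta> i) + (\<Sum>\<beta>\<in>F. unit_vec \<beta> i))"
  using F n
proof (induction F arbitrary: n rule: finite_induct)
  case empty
  then show ?case by simp
next
  case (insert \<beta> F)
  let ?e = "\<lambda>i. unit_vec \<beta> i" and ?s = "\<lambda>i. \<Sum>\<beta>\<in>F. unit_vec \<beta> i"
  have \<beta>: "\<beta> \<in> {1..r}" "\<beta> \<in> neighbours \<alpha>" "\<beta> \<noteq> \<alpha>" "\<alpha> \<in> neighbours \<beta>"
    using insert.prems \<alpha> neighbours_irrefl[of \<alpha>] neighbours_sym[of \<alpha> \<beta>]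
    by (auto simp: neighbours_def)
  have s_apply: "(\<Sum>\<beta>\<in>B. unit_vec \<beta> i') \<alpha> x = 0" if "finite B" "\<alpha> \<notin> B" for B i' x
    using that by (induction B) (auto simp: unit_vec_def)
  have s0: "?s i' \<alpha> x = 0" for i' x
    by (rule s_apply) (use insert.hyps insert.prems \<alpha> neighbours_irrefl[of \<alpha>] in auto)
  have "nonneg_at J t \<alpha> (n + ?s (i - 1) + ?s (i + 1) + neighbour_vec \<beta> i)"
    using insert.prems(2) \<beta> by (simp add: nonneg_at_def s0 neighbour_vec_apply unit_vec_def)
  then have "fsum J l (n + ?s (i - 1) + ?s (i + 1) + ?e (i - 1) + ?e (i + 1))
      = fsum J l (n + ?s (i - 1) + ?s (i + 1) + ?e i + ?e i)"
    using fsum_recursion[OF \<beta>(1) i, of l "n + ?s (i - 1) + ?s (i + 1)"] vanish by simp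
  moreover have "fsum J l ((n + ?e i + ?e i) + ?s (i - 1) + ?s (i + 1))
      = fsum J l ((n + ?e i + ?e i) + ?s i + ?s i)"
    by (rule insert.IH)
      (use insert.prems \<beta> in \<open>auto simp: nonneg_at_def unit_vec_def\<close>)
  ultimately show ?case
    by (simp only: sum.insert[OF insert.hyps] add_ac)
qed

text \<open>If the exponent at i can be lowered, the relation at i + 1 leads to two sums with top t.
  Otherwise it leaves two terms with exponent -1 at i; both are monomial multiples of one sum
  \<open>G\<close>, and they cancel.\<close>

lemma fsum_lower_top:
  assumes \<alpha>: "\<alpha> \<in> {1..r}" and J: "J = Suc (Suc i)"
    and vanish: "\<And>n. nonneg_at J t \<alpha> n \<Longrightarrow> fsum J l n = 0"
    and n: "nonneg_at J (Suc t) \<alpha> n"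
  shows "fsum J l n = 0"
proof -
  let ?D = "fsum J l" and ?e = "unit_vec \<alpha>" and ?c = "neighbour_vec \<alpha>"
  have c0: "?c x \<alpha> y = 0" for x y
    using neighbours_irrefl[OF \<alpha>] by (simp add: neighbour_vec_apply)
  have minsum_c: "minsum J ((n' + ?c x) \<alpha>) y = minsum J (n' \<alpha>) y" for n' x y
    by (rule minsum_cong) (simp add: c0)
  show ?thesis
  \<comment> \<open>For i = 0 the subtracted \<open>?e i\<close> lies outside positions 1 to
    J.\<close>
  proof (cases "i = 0 \<or> n \<alpha> i \<ge> 1")
    case True
    define X where "X = n - ?e i - ?e (i + 2)"
    have "n = X + ?e (i + 1 - 1) + ?e (i + 1 + 1)"
      by (simp add: X_def)
    moreover have "nonneg_at J t \<alpha> (X + ?e (i + 1) + ?e (i + 1))" "nonneg_at J t \<alpha> X"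
      using n True J by (auto simp: X_def nonneg_at_def unit_vec_def)
    ultimately show ?thesis
      using fsum_recursion[OF \<alpha>, of "i + 1" J l X] vanish J nonneg_at_neighbour[OF \<alpha>]
      by simp
  next
    case False
    then have i: "1 \<le> i" by simp
    then have "i \<in> {1..J}" using J by simp
    then have "n \<alpha> i \<ge> 0" using n by (simp only: nonneg_at_def)
    then have ni: "n \<alpha> i = 0" using False by simp
    \<comment> \<open>At \<alpha> this is -1 at i and t at the top. Subtracting
      \<open>?c (i - 1)\<close>, the division by \<open>c\<^sub>i\<^sub>-\<^sub>1\<close>, affects
      only the neighbours.\<close>
    define Z where "Z = n - ?e i - ?e (i + 2) - ?c (i - 1)"
    define w where "w = minsum J (Z \<alpha>)"
    have Z_apply: "Z \<alpha> x = n \<alpha> x - (if x = i \<or> x = i + 2 then 1 else 0)" for x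
      by (auto simp: Z_def c0 unit_vec_def)
    \<comment> \<open>Raising position i repairs the exponent -1; the sums at such parameters vanish
      by \<open>vanish\<close>.\<close>
    have good: "nonneg_at J t \<alpha> (Z + y)"
      if "\<And>x. y \<alpha> x \<ge> 0" "y \<alpha> i \<ge> 1" "y \<alpha> J = 0" for y
      unfolding nonneg_at_def
    proof (intro conjI ballI)
      fix x assume "x \<in> {1..J}"
      then show "0 \<le> (Z + y) \<alpha> x"
        using n that(1)[of x] that(2) ni J
        by (cases "x = i"; cases "x = J") (auto simp: Z_apply nonneg_at_def)
    qed (use n that(3) J in \<open>auto simp: Z_apply nonneg_at_def\<close>)
    define G where "G = ?D (Z + ?e (i - 1) + ?e (i - 1) + ?e (i + 1) + ?e (i + 1))"

    have start: "?D n = ?D (Z + ?c (i - 1) + ?e (i + 1) + ?e (i + 1))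
        - qpow (- (w (i + 1) + int (i + 1))) * ?D (Z + ?c (i - 1) + ?c (i + 1))"
    proof -
      have "n = Z + ?c (i - 1) + ?e (i + 1 - 1) + ?e (i + 1 + 1)"
        by (simp add: Z_def)
      then show ?thesis
        using fsum_recursion[OF \<alpha>, of "i + 1" J l "Z + ?c (i - 1)"] J
        unfolding minsum_c w_def by simp
    qed

    \<comment> \<open>The relation at i - 1, whose middle term contains \<open>?e i\<close> and
      vanishes. For i = 1 the vectors at position 0 have no effect.\<close>
    have first: "?D (Z + ?c (i - 1) + ?e (i + 1) + ?e (i + 1)) = qpow (w (i - 1) + 3 * int (i - 1)) * G"
    proof (cases "i = 1")
      case True
      have "?D (Z + ?c (i - 1) + ?e (i + 1) + ?e (i + 1)) = G"
        unfolding G_def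
        by (rule fsum_cong) (use True in \<open>auto simp: neighbour_vec_apply unit_vec_def\<close>)
      then show ?thesis using True by (simp add: w_def qpow_0)
    next
      case False
      then have i': "1 \<le> i - 1" "i - 1 < J" "i - 1 \<le> J" "i + 1 \<le> J" using i J by auto
      let ?N = "Z + ?e (i + 1) + ?e (i + 1)"
      have "nonneg_at J t \<alpha> (Z + (?e (i + 1) + ?e (i + 1) + ?e (i - 1 - 1) + ?e i))"
        by (rule good) (use J in \<open>auto simp: unit_vec_def\<close>)
      then have "?D (?N + ?e (i - 1 - 1) + ?e (i - 1 + 1)) = 0"
        using vanish i by (simp add: add.assoc)
      moreover have "minsum J (?N \<alpha>) (i - 1) = w (i - 1) + 2 * int (i - 1)"
        unfolding w_def plus_fun_apply minsum_add minsum_unit_vec[OF i'(4)] by simp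
      moreover have "?N + ?e (i - 1) + ?e (i - 1) = Z + ?e (i - 1) + ?e (i - 1) + ?e (i + 1) + ?e (i + 1)"
        by (simp only: add_ac)
      ultimately have "G = qpow (- (w (i - 1) + 2 * int (i - 1) + int (i - 1))) * ?D (?N + ?c (i - 1))"
        using fsum_recursion[OF \<alpha> i'(1,2), of l ?N] by (simp only: G_def add_0_left)
      moreover have "?N + ?c (i - 1) = Z + ?c (i - 1) + ?e (i + 1) + ?e (i + 1)"
        by (simp only: add_ac)
      moreover have "qpow (w (i - 1) + 3 * int (i - 1)) * qpow (- (w (i - 1) + 2 * int (i - 1) + int (i - 1))) = 1"
        by (simp add: qpow_0 flip: qpow_add)
      ultimately show ?thesis by (simp only: mult.assoc[symmetric] mult_1_left)
    qed

    have exponent: "(w i + int i) + (w i + 3 * int i - 1) = 2 * w i + 4 * int i - 1" by simp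
    have iJ: "i < J" "i \<le> J" "i - 1 \<le> J" "i + 1 \<le> J" using J by auto
    \<comment> \<open>Exchange \<open>?c (i - 1) + ?c (i + 1)\<close> for twice \<open>?c i\<close>,
      then trade each \<open>?c i\<close> for \<open>?e (i - 1) + ?e (i + 1)\<close> by the relation
      at i, whose left side vanishes. The two minus signs cancel.\<close>
    have "?D (Z + ?c (i - 1) + ?c (i + 1)) = ?D (Z + ?c i + ?c i)"
      unfolding neighbour_vec_def
    proof (rule fsum_exchange_neighbours[OF \<alpha> i iJ(1) vanish])
      show "nonneg_at J t \<alpha> (Z + ?e i)"
        by (rule good) (use J in \<open>auto simp: unit_vec_def\<close>)
    qed auto
    also have "?D (Z + ?c i + ?c i)
        = - qpow (w i + int i) * ?D (Z + ?c i + ?e (i - 1) + ?e (i + 1))"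
    proof -
      have "nonneg_at J t \<alpha> (Z + (?c i + ?e i + ?e i))"
        by (rule good) (use J in \<open>auto simp: unit_vec_def c0\<close>)
      then have "?D (Z + ?c i + ?e i + ?e i) = 0"
        using vanish by (simp only: add.assoc)
      then have "qpow (- (w i + int i)) * ?D (Z + ?c i + ?c i) = - ?D (Z + ?c i + ?e (i - 1) + ?e (i + 1))"
        using fsum_recursion[OF \<alpha> i iJ(1), of l "Z + ?c i"] unfolding minsum_c w_def
        by (simp only: eq_neg_iff_add_eq_0 add.commute)
      then have "qpow (w i + int i) * (qpow (- (w i + int i)) * ?D (Z + ?c i + ?c i))
          = - qpow (w i + int i) * ?D (Z + ?c i + ?e (i - 1) + ?e (i + 1))"
        by simp
      moreover have "qpow (w i + int i) * qpow (- (w i + int i)) = 1"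
        by (simp add: qpow_0 flip: qpow_add)
      ultimately show ?thesis by (simp only: mult.assoc[symmetric] mult_1_left)
    qed
    also have "?D (Z + ?c i + ?e (i - 1) + ?e (i + 1)) = - qpow (w i + 3 * int i - 1) * G"
    proof -
      let ?Y = "Z + ?e (i - 1) + ?e (i + 1)"
      have "nonneg_at J t \<alpha> (Z + (?e (i - 1) + ?e (i + 1) + ?e i + ?e i))"
        by (rule good) (use J in \<open>auto simp: unit_vec_def\<close>)
      then have "?D (?Y + ?e i + ?e i) = 0"
        using vanish by (simp only: add.assoc)
      moreover have "minsum J (?Y \<alpha>) i = w i + 2 * int i - 1"
        unfolding w_def plus_fun_apply minsum_add minsum_unit_vec[OF iJ(3)] minsum_unit_vec[OF iJ(4)]
        using i by simp
      moreover have "?Y + ?e (i - 1) + ?e (i + 1) = Z + ?e (i - 1) + ?e (i - 1) + ?e (i + 1) + ?e (i + 1)"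
        by (simp only: add_ac)
      ultimately have "qpow (- (w i + 2 * int i - 1 + int i)) * ?D (?Y + ?c i) = - G"
        using fsum_recursion[OF \<alpha> i iJ(1), of l ?Y]
        by (simp only: G_def eq_neg_iff_add_eq_0 add.commute)
      then have "qpow (w i + 3 * int i - 1) * (qpow (- (w i + 2 * int i - 1 + int i)) * ?D (?Y + ?c i))
          = - qpow (w i + 3 * int i - 1) * G"
        by simp
      moreover have "qpow (w i + 3 * int i - 1) * qpow (- (w i + 2 * int i - 1 + int i)) = 1"
        by (simp add: qpow_0 flip: qpow_add)
      moreover have "?Y + ?c i = Z + ?c i + ?e (i - 1) + ?e (i + 1)"
        by (simp only: add_ac)
      ultimately show ?thesis by (simp only: mult.assoc[symmetric] mult_1_left)
    qed
    finally have second: "?D (Z + ?c (i - 1) + ?c (i + 1)) = qpow (2 * w i + 4 * int i - 1) * G"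
      using exponent
      by (simp only: mult_minus_left mult_minus_right minus_minus mult.assoc[symmetric] qpow_add[symmetric])

    \<comment> \<open>The exponent of \<open>Z\<close> at (\<alpha>, i) is -1, and the resulting 1
      makes the two powers of q agree.\<close>
    have "w (i - 1) + w (i + 1) = 2 * w i + 1"
      using minsum_second_difference[of "i - 1" J "Z \<alpha>"] i J ni by (simp add: w_def Z_apply)
    then have "w (i - 1) + 3 * int (i - 1) = - (w (i + 1) + int (i + 1)) + (2 * w i + 4 * int i - 1)"
      using i by simp
    then show ?thesis
      unfolding start first second by (simp only: qpow_add mult.assoc diff_self)
  qed
qed

text \<open>Outer induction on the level, inner induction on the top exponent at \<alpha>:
  \<open>fsum_lower_top\<close> brings it to 0, where \<open>fsum_top_zero\<close> lowers the level.
  At level 2 the hypothesis on lower levels is vacuous.\<close>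

lemma fsum_vanish:
  assumes \<alpha>: "\<alpha> \<in> {1..r}" and n: "\<forall>i\<in>{1..Suc (Suc j)}. n \<alpha> i \<ge> 0"
  shows "fsum (Suc (Suc j)) (\<lambda>_. -1) n = 0"
  using n
proof (induction j arbitrary: n)
  case (0 n)
  have "nonneg_at (Suc (Suc 0)) t \<alpha> n \<Longrightarrow> fsum (Suc (Suc 0)) (\<lambda>_. -1) n = 0" for t n
  proof (induction t arbitrary: n)
    case 0
    then show ?case by (rule fsum_top_zero[OF \<alpha>]) simp
  next
    case (Suc t)
    show ?case by (rule fsum_lower_top[OF \<alpha> refl Suc.IH Suc.prems])
  qed
  from this[of "nat (n \<alpha> (Suc (Suc 0)))" n] 0 show ?case by (simp add: nonneg_at_def)
next
  case (Suc j n)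
  have "nonneg_at (Suc (Suc (Suc j))) t \<alpha> n \<Longrightarrow> fsum (Suc (Suc (Suc j))) (\<lambda>_. -1) n = 0" for t n
  proof (induction t arbitrary: n)
    case 0
    then show ?case by (rule fsum_top_zero[OF \<alpha>]) (rule Suc.IH)
  next
    case (Suc t)
    show ?case by (rule fsum_lower_top[OF \<alpha> refl Suc.IH Suc.prems])
  qed
  from this[of "nat (n \<alpha> (Suc (Suc (Suc j))))" n] Suc.prems show ?case
    by (simp add: nonneg_at_def)
qed

subsection \<open>Removing the positivity constraints\<close>

text \<open>The terms in which the two sides differ have vacancies \<ge> 0 beyond j and a negative
  one at some (\<alpha>, j). Then \<open>n\<^sub>j + p\<^sub>j\<^sub>+\<^sub>1 + 1\<close> and
  \<open>-p\<^sub>j - 1\<close> are nonnegative at \<alpha>, so each tail class sums to 0 by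
  \<open>fsum_vanish\<close>.\<close>

lemma sum_weight_drop_nonneg:
  assumes n: "\<And>\<alpha> i. n \<alpha> i \<ge> 0" and j: "1 \<le> j" "j < k"
  shows "(\<Sum>m | m \<in> configs k l n \<and> (\<forall>\<alpha>\<in>{1..r}. \<forall>i\<in>{j..k}. vacancy k m n \<alpha> i \<ge> 0). weight k m n)
    = (\<Sum>m | m \<in> configs k l n \<and> (\<forall>\<alpha>\<in>{1..r}. \<forall>i\<in>{Suc j..k}. vacancy k m n \<alpha> i \<ge> 0). weight k m n)"
    (is "sum _ ?P = sum _ ?Q")
proof -
  have sub: "?P \<subseteq> ?Q" and fin: "finite ?Q"
    by (auto intro: rev_finite_subset[OF finite_configs])
  have "sum (\<lambda>m. weight k m n) (?Q - ?P) = 0"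
  proof (rule sum_eq_0_by_tails[where j = j])
    show "finite (?Q - ?P)" using fin by simp
  next
    fix m0 assume m0': "m0 \<in> ?Q - ?P"
    then have m0: "m0 \<in> configs k l n" by simp
    \<comment> \<open>Vacancies from j on depend only on the tail, so the difference set consists of
      full tail classes, as \<open>fsum_tail\<close> requires.\<close>
    have tail: "m \<in> ?Q - ?P \<and> tail j m = tail j m0 \<longleftrightarrow> m \<in> configs k l n \<and> tail j m = tail j m0" for m
    proof (cases "m \<in> configs k l n \<and> tail j m = tail j m0")
      case True
      then have "vacancy k m n \<alpha> i = vacancy k m0 n \<alpha> i" if "\<alpha> \<in> {1..r}" "j \<le> i" for \<alpha> i
        using vacancy_tail_cong[OF _ m0 _ that(2) _ that(1), of m] j by simp
      then show ?thesis using m0' True j by auto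
    qed auto
    obtain \<alpha> i where \<alpha>: "\<alpha> \<in> {1..r}" "i \<in> {j..k}" "vacancy k m0 n \<alpha> i < 0"
      using m0' by (auto simp: not_le)
    have upper: "vacancy k m0 n \<alpha> i \<ge> 0" if "i \<in> {Suc j..k}" for i
      using m0' \<alpha>(1) that by auto
    with \<alpha> have "i = j" by (metis atLeastAtMost_iff le_neq_implies_less not_le Suc_leI)
    obtain j' where j': "j = Suc j'" using j by (cases j) auto
    have "fsum (Suc j) (\<lambda>_. -1) (tail_params k j m0 n) = 0"
      unfolding j'
    proof (rule fsum_vanish[OF \<alpha>(1)])
      show "\<forall>x\<in>{1..Suc (Suc j')}. tail_params k (Suc j') m0 n \<alpha> x \<ge> 0"
        using n upper[of "Suc j"] \<alpha>(3) j unfolding \<open>i = j\<close>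
        by (auto simp: tail_params_def j')
    qed
    then have "(\<Sum>m | m \<in> configs k l n \<and> tail j m = tail j m0. weight k m n) = 0"
      using fsum_tail[OF m0 j] by auto
    then show "(\<Sum>m | m \<in> ?Q - ?P \<and> tail j m = tail j m0. weight k m n) = 0"
      by (simp only: tail)
  qed
  then show ?thesis using sum.subset_diff[OF sub fin, of "\<lambda>m. weight k m n"] by simp
qed

lemma sum_weight_nonneg:
  assumes n: "\<And>\<alpha> i. n \<alpha> i \<ge> 0" and l: "\<And>\<alpha>. l \<alpha> \<ge> 0" and k: "1 \<le> k"
  shows "(\<Sum>m | m \<in> configs k l n \<and> (\<forall>\<alpha>\<in>{1..r}. \<forall>i\<in>{1..k}. vacancy k m n \<alpha> i \<ge> 0). weight k m n)
    = fsum k l n"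
proof -
  have "(\<Sum>m | m \<in> configs k l n \<and> (\<forall>\<alpha>\<in>{1..r}. \<forall>i\<in>{1..k}. vacancy k m n \<alpha> i \<ge> 0). weight k m n)
    = (\<Sum>m | m \<in> configs k l n \<and> (\<forall>\<alpha>\<in>{1..r}. \<forall>i\<in>{j..k}. vacancy k m n \<alpha> i \<ge> 0). weight k m n)"
    if "1 \<le> j" "j \<le> k" for j
    using that
  proof (induction j rule: dec_induct)
    case (step j)
    then show ?case using sum_weight_drop_nonneg[where n = n and j = j and k = k and l = l, OF n] by simp
  qed simp
  from this[OF k order.refl]
  have "(\<Sum>m | m \<in> configs k l n \<and> (\<forall>\<alpha>\<in>{1..r}. \<forall>i\<in>{1..k}. vacancy k m n \<alpha> i \<ge> 0). weight k m n)
    = (\<Sum>m | m \<in> configs k l n \<and> (\<forall>\<alpha>\<in>{1..r}. \<forall>i\<in>{k..k}. vacancy k m n \<alpha> i \<ge> 0). weight k m n)" .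
  also have "{m. m \<in> configs k l n \<and> (\<forall>\<alpha>\<in>{1..r}. \<forall>i\<in>{k..k}. vacancy k m n \<alpha> i \<ge> 0)} = configs k l n"
    using l by (auto simp: configs_def)
  finally show ?thesis by (simp add: fsum_def)
qed

end

theorem theorem5p1:
  fixes r k :: nat
    and C :: "nat \<Rightarrow> nat \<Rightarrow> int"
    and l :: "nat \<Rightarrow> nat"
    and n :: "nat \<Rightarrow> nat \<Rightarrow> nat"
  assumes "cartan_matrix r C" and "indecomposable r C" and "simply_laced r C"
    and "k \<ge> 1"
  shows "M_poly r k C l n = N_poly r k C l n"
proof -
  interpret simply_laced_cartan r C
    by unfold_locales (fact assms)+
  have "(\<Sum>m | m \<in> admissible r k C l n \<and> (\<forall>\<alpha>\<in>{1..r}. \<forall>i\<in>{1..k}. pvec r k C m n \<alpha> i \<ge> 0). summand r k C m n)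
    = (\<Sum>m\<in>admissible r k C l n. summand r k C m n)"
    unfolding admissible_eq_configs pvec_eq_vacancy summand_eq_weight fsum_def[symmetric]
    by (rule sum_weight_nonneg) (use assms in auto)
  then show ?thesis by (simp only: M_poly_def N_poly_def)
qed

end
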